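(* Let $\Gamma$ be a countable group equipped with a homomorphism $[\,\cdot\,]\colon\Gamma\to\mathbb{Z}$. Suppose that $a$ and $b$ are distinct elements of $\Gamma$ with $[a]=[b]=1$, and that $M\ge 3$ is an integer. Let $f=M-a-b\in\mathbb{Z}\Gamma$. Then the principal algebraic $\Gamma$-action $(X_f,\alpha_f)$, equipped with Haar measure $\mu_f$, is measurably isomorphic to the Bernoulli $\Gamma$-action on $\{0,1,\dots,M-1\}^{\Gamma}$ with the uniform base probability measure.
   Context: $\Gamma$ is considered as a discrete group, $\mathbb{T}=\mathbb{R}/\mathbb{Z}$, and $\mathbb{Z}\Gamma$ is the integral group ring. For $f=\sum_s f_s s\in\mathbb{Z}\Gamma$, the principal algebraic $\Gamma$-action defined by $f$ is $(X_f,\alpha_f)$, where $X_f=\{x\in\mathbb{T}^{\Gamma}:\sum_{s\in\Gamma}f_s x_{ts}=0\text{ in }\mathbb{T}\text{ for every }t\in\Gamma\}$ is a compact abelian group (the Pontryagin dual of $\mathbb{Z}\Gamma/\mathbb{Z}\Gamma f$, where $\mathbb{Z}\Gamma f$ is the principal left ideal generated by $f$), and $\alpha_f$ is the action of $\Gamma$ on $X_f$ given by $(\alpha_f^s x)_t=x_{s^{-1}t}$. $\mu_f$ is normalized Haar measure on $X_f$, which is preserved by $\alpha_f$. The Bernoulli $\Gamma$-action is the shift action $(\sigma^s d)_t=d_{s^{-1}t}$ on $\{0,1,\dots,M-1\}^{\Gamma}$ with the product measure $\nu_0^{\otimes\Gamma}$, where $\nu_0$ is the uniform probability measure on $\{0,1,\dots,M-1\}$.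 A measurable isomorphism of measure-preserving actions is a measure-preserving, equivariant map that is a bijection between invariant subsets of full measure, bimeasurably. *)

theory Defs
  imports "HOL-Probability.Probability" "HOL-Library.Poly_Mapping" "HOL-Library.Function_Algebras"
begin

text \<open>A group is a type of class \<open>group_add\<close>, which is written additively but is not assumed
  commutative: the product \<open>t s\<close> reads \<open>t + s\<close>, and \<open>s\<^sup>-\<^sup>1 t\<close> reads \<open>- s + t\<close>.  The integral group
  ring of \<open>'g\<close> is the type \<open>'g \<Rightarrow>\<^sub>0 int\<close> of finitely supported functions, whose multiplication
  is convolution.\<close>

subsection \<open>The circle group\<close>

quotient_type circle = real / "\<lambda>x y :: real. x - y \<in> \<int>"
  morphisms rep_circle to_circle
proof (rule equivpI)
  show "reflp (\<lambda>x y :: real. x - y \<in> \<int>)"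
    by (simp add: reflp_def)
  show "symp (\<lambda>x y :: real. x - y \<in> \<int>)"
    by (metis (no_types, lifting) Ints_minus minus_diff_eq sympI)
  show "transp (\<lambda>x y :: real. x - y \<in> \<int>)"
  proof (rule transpI)
    fix x y z :: real
    assume "x - y \<in> \<int>" "y - z \<in> \<int>"
    then have "(x - y) + (y - z) \<in> \<int>" by (rule Ints_add)
    then show "x - z \<in> \<int>" by simp
  qed
qed

instantiation circle :: ab_group_add
begin

lift_definition zero_circle :: circle is "0 :: real" .

lift_definition plus_circle :: "circle \<Rightarrow> circle \<Rightarrow> circle" is "(+) :: real \<Rightarrow> real \<Rightarrow> real"
proof -
  fix x x' y y' :: real
  assume "x - x' \<in> \<int>" "y - y' \<in> \<int>"
  then have "(x - x') + (y - y') \<in> \<int>" by (rule Ints_add)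
  then show "(x + y) - (x' + y') \<in> \<int>" by (simp add: algebra_simps)
qed

lift_definition uminus_circle :: "circle \<Rightarrow> circle" is "uminus :: real \<Rightarrow> real"
proof -
  fix x x' :: real
  assume "x - x' \<in> \<int>"
  then have "- (x - x') \<in> \<int>" by (rule Ints_minus)
  then show "- x - - x' \<in> \<int>" by (simp add: algebra_simps)
qed

lift_definition minus_circle :: "circle \<Rightarrow> circle \<Rightarrow> circle" is "(-) :: real \<Rightarrow> real \<Rightarrow> real"
proof -
  fix x x' y y' :: real
  assume "x - x' \<in> \<int>" "y - y' \<in> \<int>"
  then have "(x - x') - (y - y') \<in> \<int>" by (rule Ints_diff)
  then show "(x - y) - (x' - y') \<in> \<int>" by (simp add: algebra_simps)
qed

instance
  by standard (transfer; simp add: algebra_simps)+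

end

lift_definition int_scale :: "int \<Rightarrow> circle \<Rightarrow> circle" is "\<lambda>n x. of_int n * x"
proof -
  fix n :: int and x y :: real
  assume "x - y \<in> \<int>"
  then have "of_int n * (x - y) \<in> \<int>" by (intro Ints_mult) auto
  then show "of_int n * x - of_int n * y \<in> \<int>" by (simp add: algebra_simps)
qed

text \<open>The circle carries the quotient topology.\<close>

instantiation circle :: topological_space
begin

definition open_circle :: "circle set \<Rightarrow> bool" where
  "open_circle U \<longleftrightarrow> open (to_circle -` U)"

instance
  by standard (auto simp: open_circle_def vimage_Union)

end

subsection \<open>Haar measure\<close>

text \<open>Here \<open>X\<close> is a compact subgroup of the ambient topological abelian group, with the subspace
  topology.  Regularity is not part of the definition, since it is automatic when \<open>X\<close> is
  metrizable, as are all closed subgroups of a countable power of the circle.\<close>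

definition is_normalized_haar :: "'a :: {ab_group_add, topological_space} set \<Rightarrow> 'a measure \<Rightarrow> bool" where
  "is_normalized_haar X \<mu> \<longleftrightarrow>
     sets \<mu> = sets (restrict_space borel X) \<and>
     prob_space \<mu> \<and>
     (\<forall>x\<in>X. \<forall>A\<in>sets \<mu>. emeasure \<mu> ((\<lambda>y. x + y) ` A) = emeasure \<mu> A)"

definition haar_measure :: "'a :: {ab_group_add, topological_space} set \<Rightarrow> 'a measure" where
  "haar_measure X = (THE \<mu>. is_normalized_haar X \<mu>)"

subsection \<open>Group actions\<close>

definition shift_action :: "'g :: group_add \<Rightarrow> ('g \<Rightarrow> 'c) \<Rightarrow> 'g \<Rightarrow> 'c" where
  "shift_action s x = (\<lambda>t. x (- s + t))"

definition principal_algebraic :: "('g :: group_add \<Rightarrow>\<^sub>0 int) \<Rightarrow> ('g \<Rightarrow> circle) set" where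
  "principal_algebraic f =
     {x. \<forall>t. (\<Sum>s\<in>Poly_Mapping.keys f. int_scale (Poly_Mapping.lookup f s) (x (t + s))) = 0}"

definition bernoulli_measure :: "nat \<Rightarrow> ('g \<Rightarrow> nat) measure" where
  "bernoulli_measure M = PiM UNIV (\<lambda>_. uniform_count_measure {0..<M})"

definition measurably_isomorphic ::
  "'a measure \<Rightarrow> ('g \<Rightarrow> 'a \<Rightarrow> 'a) \<Rightarrow> 'b measure \<Rightarrow> ('g \<Rightarrow> 'b \<Rightarrow> 'b) \<Rightarrow> bool" where
  "measurably_isomorphic \<mu> \<alpha> \<nu> \<beta> \<longleftrightarrow>
     (\<exists>X Y \<phi>.
        X \<in> sets \<mu> \<and> emeasure \<mu> (space \<mu> - X) = 0 \<and> (\<forall>s. \<alpha> s ` X = X) \<and>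
        Y \<in> sets \<nu> \<and> emeasure \<nu> (space \<nu> - Y) = 0 \<and> (\<forall>s. \<beta> s ` Y = Y) \<and>
        bij_betw \<phi> X Y \<and>
        \<phi> \<in> measurable (restrict_space \<mu> X) (restrict_space \<nu> Y) \<and>
        inv_into X \<phi> \<in> measurable (restrict_space \<nu> Y) (restrict_space \<mu> X) \<and>
        distr (restrict_space \<mu> X) (restrict_space \<nu> Y) \<phi> = restrict_space \<nu> Y \<and>
        (\<forall>s. \<forall>x\<in>X. \<phi> (\<alpha> s x) = \<beta> s (\<phi> x)))"

end

theory Submission imports Defs begin

text \<open>
  A group element \<open>t\<close> lies at level \<open>h t\<close>; both \<open>t + a\<close> and \<open>t + b\<close> lie one level
  higher. The element \<open>f = M - a - b\<close> is invertible in \<open>\<ell>\<^sup>1(\<Gamma>)\<close>, its inverse being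
  \<open>\<Sum>n. (a + b)\<^sup>n / M\<^sup>n\<^sup>+\<^sup>1\<close>. Hence a digit configuration \<open>d \<in> {0..<M}\<^sup>\<Gamma>\<close> has a real
  expansion \<open>v\<close>, the bounded solution of \<open>M v\<^sub>t - v\<^sub>t\<^sub>+\<^sub>a - v\<^sub>t\<^sub>+\<^sub>b = d\<^sub>t\<close>, and reducing it modulo 1
  gives a continuous equivariant map \<open>coding\<close> from digit configurations into \<open>X\<^sub>f\<close>. The
  isomorphism is the inverse of this map. Two facts are needed.

  \<^item> The coding maps the Bernoulli measure to Haar measure. As Haar measure is unique
    (\<open>normalized_haar_unique\<close>), it suffices that the law of \<open>coding d\<close> is invariant under
    translation by each \<open>y \<in> X\<^sub>f\<close>. Below a level \<open>n\<close>, add \<open>y\<close> to the point \<open>coding d\<close> by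
    changing the digits one level at a time: each digit is rotated modulo \<open>M\<close> by an amount
    that depends only on the digits above it, so the new digits are again Bernoulli distributed
    (\<open>twist_preserves_bernoulli_measure\<close>). Leaving the digits from level \<open>n\<close> upwards alone costs
    an error of at most 1 there, which is multiplied by at most \<open>2 / M < 1\<close> with each
    level of descent (\<open>expansion_twisted\<close>). Letting \<open>n\<close> tend to infinity gives invariance.

  \<^item> The coding is injective off a null set. If \<open>d\<close> and \<open>d'\<close> have the same code, their
    expansions differ by an integer valued function \<open>z\<close> with
    \<open>M z\<^sub>t = d\<^sub>t - d'\<^sub>t + z\<^sub>t\<^sub>+\<^sub>a + z\<^sub>t\<^sub>+\<^sub>b\<close>. Digits differ by less than \<open>M\<close>, so a positive value of
    \<open>z\<close> at \<open>t\<close> must be sustained by positive values above: by one of them if \<open>d\<^sub>t = M - 1\<close>, by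
    both if \<open>d\<^sub>t = M - 2\<close>, and smaller digits are impossible
    (\<open>percolates_if_difference_positive\<close>). The probability that such a pattern extends over
    \<open>n\<close> levels is \<open>(2 / M)\<^sup>n\<close> (\<open>emeasure_percolates\<close>), so almost surely there is none; negative
    values are treated by the reflection \<open>d\<^sub>t \<mapsto> M - 1 - d\<^sub>t\<close>.

  Measurability of the inverse comes from compactness: the coding is continuous on a compact
  space, so it maps closed sets to closed sets, and both the exceptional set and the cylinders
  are built from closed sets.
\<close>

section \<open>The circle as a topological group\<close>

lemma to_circle_eq_iff: "to_circle r = to_circle s \<longleftrightarrow> r - s \<in> \<int>"
  by (rule circle.abs_eq_iff)

lemma to_circle_surj: "\<exists>r. x = to_circle r"
  by (metis Quotient_abs_rep Quotient_circle)

lemma to_circle_add: "to_circle (r + s) = to_circle r + to_circle s"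
  by (simp add: plus_circle.abs_eq)

lemma to_circle_diff: "to_circle (r - s) = to_circle r - to_circle s"
  by (simp add: minus_circle.abs_eq)

lemma to_circle_minus: "to_circle (- r) = - to_circle r"
  by (simp add: uminus_circle.abs_eq)

lemma int_scale_to_circle: "int_scale n (to_circle r) = to_circle (of_int n * r)"
  by (simp add: int_scale.abs_eq)

lemma int_scale_minus_one: "int_scale (- 1) x = - x"
  using to_circle_surj[of x] by (auto simp: int_scale_to_circle to_circle_minus)

lemma int_scale_add: "int_scale n (x + y) = int_scale n x + int_scale n y"
  using to_circle_surj[of x] to_circle_surj[of y]
  by (auto simp: int_scale_to_circle ring_distribs simp flip: to_circle_add)

lemma int_scale_diff: "int_scale n (x - y) = int_scale n x - int_scale n y"
  using to_circle_surj[of x] to_circle_surj[of y]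
  by (auto simp: int_scale_to_circle right_diff_distrib simp flip: to_circle_diff)

lemma to_circle_minus_floor: "to_circle (r - of_int \<lfloor>r\<rfloor>) = to_circle r"
  by (simp add: to_circle_eq_iff)

lemma continuous_on_to_circle: "continuous_on UNIV to_circle"
  by (auto simp: continuous_on_open_vimage open_circle_def)

lemma open_image_to_circle:
  assumes "open U"
  shows "open (to_circle ` U)"
proof -
  have "to_circle -` (to_circle ` U) = (\<Union>n::int. (+) (of_int n) ` U)"
  proof (intro set_eqI iffI)
    fix r assume "r \<in> to_circle -` (to_circle ` U)"
    then obtain s where s: "s \<in> U" "to_circle r = to_circle s" by auto
    then obtain n where "r - s = of_int n"
      using Ints_cases to_circle_eq_iff by blast
    with s show "r \<in> (\<Union>n::int. (+) (of_int n) ` U)"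
      by (auto intro!: exI[of _ n] image_eqI[of _ _ s])
  next
    fix r assume "r \<in> (\<Union>n::int. (+) (of_int n) ` U)"
    then obtain n :: int and s where s: "s \<in> U" "r = of_int n + s" by auto
    then have "to_circle r = to_circle s" by (simp add: to_circle_eq_iff)
    with s show "r \<in> to_circle -` (to_circle ` U)" by auto
  qed
  then show ?thesis
    using assms by (auto simp: open_circle_def intro!: open_translation)
qed

instance circle :: second_countable_topology
proof
  obtain B :: "real set set" where B: "countable B" "topological_basis B"
    using ex_countable_basis by blast
  have "topological_basis ((`) to_circle ` B)"
  proof (rule topological_basisI)
    fix V assume "V \<in> (`) to_circle ` B"
    then show "open V"
      using B(2) by (auto intro: open_image_to_circle topological_basis_open)
  next
    fix U :: "circle set" and x assume U: "open U" "x \<in> U"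
    then obtain r where r: "x = to_circle r" using to_circle_surj[of x] by blast
    with U have "open (to_circle -` U)" "r \<in> to_circle -` U"
      by (auto simp: open_circle_def)
    then obtain V where "V \<in> B" "r \<in> V" "V \<subseteq> to_circle -` U"
      by (rule topological_basisE[OF B(2)])
    with r show "\<exists>V\<in>(`) to_circle ` B. x \<in> V \<and> V \<subseteq> U" by auto
  qed
  from topological_basis_imp_subbasis[OF this] B(1)
  show "\<exists>B :: circle set set. countable B \<and> open = generate_topology B"
    by (intro exI[of _ "(`) to_circle ` B"]) simp
qed

instance circle :: t2_space
proof
  fix x y :: circle assume "x \<noteq> y"
  obtain r s where rs: "x = to_circle r" "y = to_circle s"
    using to_circle_surj[of x] to_circle_surj[of y] by blast
  \<comment> \<open>the real line covers the circle by arcs, and the distance from \<open>r - s\<close> to the nearest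
    integer separates the two points\<close>
  have "r - s \<notin> \<int>" using \<open>x \<noteq> y\<close> rs by (simp add: to_circle_eq_iff)
  moreover have "open (- \<int> :: real set)" by (simp add: open_Compl)
  ultimately obtain e where e: "e > 0" "ball (r - s) e \<subseteq> - \<int>"
    unfolding open_contains_ball by blast
  let ?U = "to_circle ` ball r (e / 2)" and ?V = "to_circle ` ball s (e / 2)"
  have "?U \<inter> ?V = {}"
  proof (rule ccontr)
    assume "?U \<inter> ?V \<noteq> {}"
    then obtain r' s' where *: "r' \<in> ball r (e / 2)" "s' \<in> ball s (e / 2)" "r' - s' \<in> \<int>"
      unfolding disjoint_iff image_iff to_circle_eq_iff[symmetric] by metis
    then have "r' - s' \<in> ball (r - s) e" unfolding mem_ball dist_real_def by linarith
    with e(2) *(3) show False by blast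
  qed
  moreover have "x \<in> ?U" "y \<in> ?V" using rs e by auto
  ultimately show "\<exists>U V. open U \<and> open V \<and> x \<in> U \<and> y \<in> V \<and> U \<inter> V = {}"
    by (intro exI[of _ ?U] exI[of _ ?V] conjI open_image_to_circle open_ball)
qed

lemma continuous_on_circle_add: "continuous_on UNIV (\<lambda>p :: circle \<times> circle. fst p + snd p)"
proof (subst continuous_on_open_vimage[OF open_UNIV], intro allI impI)
  fix U :: "circle set" assume U: "open U"
  show "open ((\<lambda>p. fst p + snd p) -` U \<inter> UNIV)"
  proof (subst open_prod_def, safe)
    fix x y :: circle assume "fst (x, y) + snd (x, y) \<in> U"
    obtain r s where rs: "x = to_circle r" "y = to_circle s"
      using to_circle_surj[of x] to_circle_surj[of y] by blast
    have "open ((\<lambda>p. fst p + snd p) -` (to_circle -` U))"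
      using U by (intro open_vimage[where f = "\<lambda>p :: real \<times> real. fst p + snd p"])
        (auto simp only: open_circle_def intro!: continuous_intros)
    moreover have "(r, s) \<in> (\<lambda>p. fst p + snd p) -` (to_circle -` U)"
      using \<open>fst (x, y) + snd (x, y) \<in> U\<close> by (simp add: to_circle_add rs)
    ultimately obtain A B where AB: "open A" "open B" "(r, s) \<in> A \<times> B"
      "A \<times> B \<subseteq> (\<lambda>p. fst p + snd p) -` (to_circle -` U)"
      by (rule open_prod_elim)
    have "to_circle (p + q) \<in> U" if "p \<in> A" "q \<in> B" for p q
      using subsetD[OF AB(4), of "(p, q)"] that by simp
    then have "to_circle ` A \<times> to_circle ` B \<subseteq> (\<lambda>p. fst p + snd p) -` U \<inter> UNIV"
      by (auto simp: to_circle_add)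
    then show "\<exists>A B. open A \<and> open B \<and> (x, y) \<in> A \<times> B \<and> A \<times> B \<subseteq> (\<lambda>p. fst p + snd p) -` U \<inter> UNIV"
      using AB(1-3)
      by (intro exI[of _ "to_circle ` A"] exI[of _ "to_circle ` B"] conjI open_image_to_circle)
        (simp_all add: rs)
  qed
qed

lemma continuous_on_fun_circle_add:
  "continuous_on UNIV (\<lambda>p :: ('g \<Rightarrow> circle) \<times> ('g \<Rightarrow> circle). fst p + snd p)"
proof (rule continuous_on_coordinatewise_then_product)
  fix t :: 'g
  have "continuous_on UNIV (\<lambda>p :: ('g \<Rightarrow> circle) \<times> ('g \<Rightarrow> circle). (fst p t, snd p t))"
    by (intro continuous_on_Pair continuous_on_product_then_coordinatewise[OF continuous_on_fst]
        continuous_on_product_then_coordinatewise[OF continuous_on_snd] continuous_on_id)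
  from continuous_on_compose2[OF continuous_on_circle_add this]
  show "continuous_on UNIV (\<lambda>p :: ('g \<Rightarrow> circle) \<times> ('g \<Rightarrow> circle). (fst p + snd p) t)"
    by simp
qed

text \<open>Stated for function spaces with the product topology, this is what makes images of
  compact sets of digit configurations Borel.\<close>

lemma compact_imp_closed_fun:
  fixes K :: "('g \<Rightarrow> 'c :: t2_space) set"
  assumes "compact K"
  shows "closed K"
proof -
  have "Hausdorff_space (euclidean :: 'c topology)"
    unfolding Hausdorff_space_def disjnt_def using hausdorff[where 'a = 'c] by simp
  then have "Hausdorff_space (euclidean :: ('g \<Rightarrow> 'c) topology)"
    unfolding euclidean_product_topology[symmetric, where 'a = 'g and 'b = 'c]
      Hausdorff_space_product_topology by simp
  then show ?thesis
    using compactin_imp_closedin[of euclidean K] assms by simp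
qed

lemma tendsto_pointwise:
  fixes F :: "'b \<Rightarrow> 'g \<Rightarrow> 'c :: topological_space"
  assumes "\<And>t. ((\<lambda>k. F k t) \<longlongrightarrow> L t) G"
  shows "(F \<longlongrightarrow> L) G"
proof -
  have "limitin (product_topology (\<lambda>_. euclidean) UNIV) F L G"
    unfolding limitin_componentwise using assms by simp
  then show ?thesis by (simp add: euclidean_product_topology)
qed

lemma continuous_on_circle_translate:
  fixes y :: "'g \<Rightarrow> circle"
  shows "continuous_on UNIV (\<lambda>z. z + y)"
  using continuous_on_compose2[OF continuous_on_fun_circle_add
      continuous_on_Pair[OF continuous_on_id continuous_on_const]] by simp

lemma measurable_circle_translate:
  fixes y :: "'g \<Rightarrow> circle"
  shows "(\<lambda>z. z + y) \<in> borel_measurable borel"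
  by (rule borel_measurable_continuous_onI[OF continuous_on_circle_translate])

lemma open_circle_translate:
  fixes y :: "'g \<Rightarrow> circle"
  assumes "open U"
  shows "open {z. z + y \<in> U}"
  using open_vimage[OF assms continuous_on_circle_translate] by (simp add: vimage_def)

section \<open>Uniqueness of Haar measure\<close>

text \<open>Integrate the indicator of \<open>x + y \<in> A\<close> against \<open>\<mu> \<Otimes> \<nu>\<close> in both orders: the inner
  integral is \<open>\<nu> A\<close> in one order and \<open>\<mu> A\<close> in the other. Second countability makes addition
  measurable for the product \<open>\<sigma>\<close>-algebra, so Fubini applies.\<close>

lemma normalized_haar_unique:
  fixes X :: "'a :: {ab_group_add, second_countable_topology} set"
  assumes cont: "continuous_on UNIV (\<lambda>p :: 'a \<times> 'a. fst p + snd p)"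
    and add: "\<And>x y. x \<in> X \<Longrightarrow> y \<in> X \<Longrightarrow> x + y \<in> X"
    and minus: "\<And>x. x \<in> X \<Longrightarrow> - x \<in> X"
    and 1: "is_normalized_haar X \<mu>" and 2: "is_normalized_haar X \<nu>"
  shows "\<mu> = \<nu>"
proof (rule measure_eqI)
  let ?R = "restrict_space borel X"
  have [measurable_cong]: "sets \<mu> = sets ?R" "sets \<nu> = sets ?R"
    using 1 2 by (auto simp: is_normalized_haar_def)
  then show "sets \<mu> = sets \<nu>" by simp
  have sp: "space \<mu> = X" "space \<nu> = X"
    using \<open>sets \<mu> = sets ?R\<close>[THEN sets_eq_imp_space_eq] \<open>sets \<nu> = sets ?R\<close>[THEN sets_eq_imp_space_eq]
    by (auto simp: space_restrict_space)
  interpret \<mu>: prob_space \<mu> using 1 by (simp add: is_normalized_haar_def)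
  interpret \<nu>: prob_space \<nu> using 2 by (simp add: is_normalized_haar_def)
  interpret pair_sigma_finite \<mu> \<nu> ..
  have [measurable]: "(\<lambda>x. x) \<in> measurable \<mu> borel" "(\<lambda>x. x) \<in> measurable \<nu> borel"
    by (simp_all add: \<open>sets \<mu> = sets ?R\<close> \<open>sets \<nu> = sets ?R\<close> measurable_restrict_space1 cong: measurable_cong_sets)
  have "(\<lambda>p :: 'a \<times> 'a. fst p + snd p) \<in> borel_measurable borel"
    using cont by (rule borel_measurable_continuous_onI)
  then have plus: "(\<lambda>p :: 'a \<times> 'a. fst p + snd p) \<in> borel_measurable (borel \<Otimes>\<^sub>M borel)"
    by (simp add: borel_prod)
  have "(\<lambda>p. (fst p, snd p)) \<in> measurable (\<mu> \<Otimes>\<^sub>M \<nu>) (borel \<Otimes>\<^sub>M borel)"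
    by measurable
  from measurable_compose[OF this plus]
  have meas: "(\<lambda>p. fst p + snd p) \<in> borel_measurable (\<mu> \<Otimes>\<^sub>M \<nu>)" by simp
  fix A assume A: "A \<in> sets \<mu>"
  then obtain B where B: "B \<in> sets borel" "A = X \<inter> B"
    by (auto simp: \<open>sets \<mu> = sets ?R\<close> sets_restrict_space)
  have translate: "{y \<in> X. x + y \<in> A} = (\<lambda>y. - x + y) ` A" if "x \<in> X" for x
  proof (intro set_eqI iffI)
    fix y assume "y \<in> {y \<in> X. x + y \<in> A}"
    then show "y \<in> (\<lambda>y. - x + y) ` A" by (intro image_eqI[of _ _ "x + y"]) (auto simp: algebra_simps)
  next
    fix y assume "y \<in> (\<lambda>y. - x + y) ` A"
    then show "y \<in> {y \<in> X. x + y \<in> A}"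
      using add[OF minus[OF that]] B by (auto simp: algebra_simps)
  qed
  define S where "S = (\<lambda>p. fst p + snd p) -` B \<inter> space (\<mu> \<Otimes>\<^sub>M \<nu>)"
  have S: "S \<in> sets (\<mu> \<Otimes>\<^sub>M \<nu>)"
    unfolding S_def using meas B(1) by (rule measurable_sets)
  have "emeasure (\<mu> \<Otimes>\<^sub>M \<nu>) S = (\<integral>\<^sup>+x. emeasure \<nu> (Pair x -` S) \<partial>\<mu>)"
    by (rule \<nu>.emeasure_pair_measure_alt[OF S])
  also have "\<dots> = (\<integral>\<^sup>+x. emeasure \<nu> A \<partial>\<mu>)"
  proof (rule nn_integral_cong)
    fix x assume "x \<in> space \<mu>"
    then have x: "x \<in> X" by (simp add: sp)
    then have "Pair x -` S = {y \<in> X. x + y \<in> A}"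
      using add B by (auto simp: S_def space_pair_measure sp)
    then show "emeasure \<nu> (Pair x -` S) = emeasure \<nu> A"
      using 2 A minus[OF x] by (simp add: translate[OF x] is_normalized_haar_def
        \<open>sets \<mu> = sets ?R\<close> del: minus_add_cancel uminus_add_conv_diff)
  qed
  also have "\<dots> = emeasure \<nu> A" by (simp add: \<mu>.emeasure_space_1)
  finally have 3: "emeasure (\<mu> \<Otimes>\<^sub>M \<nu>) S = emeasure \<nu> A" .
  have "emeasure (\<mu> \<Otimes>\<^sub>M \<nu>) S = (\<integral>\<^sup>+y. emeasure \<mu> ((\<lambda>x. (x, y)) -` S) \<partial>\<nu>)"
    by (rule emeasure_pair_measure_alt2[OF S])
  also have "\<dots> = (\<integral>\<^sup>+y. emeasure \<mu> A \<partial>\<nu>)"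
  proof (rule nn_integral_cong)
    fix y assume "y \<in> space \<nu>"
    then have y: "y \<in> X" by (simp add: sp)
    then have "(\<lambda>x. (x, y)) -` S = {x \<in> X. y + x \<in> A}"
      using add B by (auto simp: S_def space_pair_measure sp add.commute)
    then show "emeasure \<mu> ((\<lambda>x. (x, y)) -` S) = emeasure \<mu> A"
      using 1 A minus[OF y] by (simp add: translate[OF y] is_normalized_haar_def
        del: minus_add_cancel uminus_add_conv_diff)
  qed
  also have "\<dots> = emeasure \<mu> A" by (simp add: \<nu>.emeasure_space_1)
  finally show "emeasure \<mu> A = emeasure \<nu> A" using 3 by simp
qed

lemma haar_measure_eqI:
  fixes X :: "('g :: countable \<Rightarrow> circle) set"
  assumes "\<And>x y. x \<in> X \<Longrightarrow> y \<in> X \<Longrightarrow> x + y \<in> X" "\<And>x. x \<in> X \<Longrightarrow> - x \<in> X"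
    and "is_normalized_haar X \<mu>"
  shows "haar_measure X = \<mu>"
  unfolding haar_measure_def
proof (rule the_equality)
  fix \<nu> assume "is_normalized_haar X \<nu>"
  from normalized_haar_unique[OF continuous_on_fun_circle_add assms(1,2) this assms(3)]
  show "\<nu> = \<mu>" .
qed (rule assms(3))

section \<open>Twisting the Bernoulli measure\<close>

lemma space_bernoulli_measure: "space (bernoulli_measure M) = {d. \<forall>t. d t < M}"
  by (auto simp: bernoulli_measure_def space_PiM space_uniform_count_measure PiE_UNIV_domain)

lemma prob_space_bernoulli_measure: "M > 0 \<Longrightarrow> prob_space (bernoulli_measure M)"
  by (auto simp: bernoulli_measure_def intro!: prob_space_PiM prob_space_uniform_count_measure)

lemma measurable_count_space_combine:
  fixes f :: "'a \<Rightarrow> 'b :: countable" and g :: "'a \<Rightarrow> 'c :: countable"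
  assumes "f \<in> measurable N (count_space UNIV)" "g \<in> measurable N (count_space UNIV)"
  shows "(\<lambda>x. H (f x) (g x)) \<in> measurable N (count_space UNIV)"
  using measurable_compose[OF measurable_Pair[OF assms], of "\<lambda>p. H (fst p) (snd p)" "count_space UNIV"]
  by (simp add: pair_measure_countable)

lemma measurable_bernoulli_coordinate:
  "(\<lambda>d. d t) \<in> measurable (bernoulli_measure M) (count_space UNIV)"
proof -
  have "(\<lambda>d. d t) \<in> measurable (bernoulli_measure M) (uniform_count_measure {0..<M})"
    unfolding bernoulli_measure_def by (rule measurable_component_singleton) simp
  moreover have "(\<lambda>n :: nat. n) \<in> measurable (uniform_count_measure {0..<M}) (count_space UNIV)"
    by (auto simp: measurable_def space_uniform_count_measure sets_uniform_count_measure)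
  ultimately show ?thesis by (rule measurable_compose)
qed

lemma measurable_into_bernoulli_measure:
  assumes "\<And>t. (\<lambda>x. T x t) \<in> measurable N (count_space UNIV)" "\<And>x t. x \<in> space N \<Longrightarrow> T x t < M"
  shows "T \<in> measurable N (bernoulli_measure M)"
proof -
  have "(\<lambda>x. T x t) \<in> measurable N (uniform_count_measure {0..<M})" for t
  proof (subst measurable_cong_sets[OF refl, of _ "count_space {0..<M}"])
    show "(\<lambda>x. T x t) \<in> measurable N (count_space {0..<M})"
      using assms(2) measurable_sets[OF assms(1), of "{_}" t]
      by (auto simp: measurable_count_space_eq_countable)
  qed (simp add: sets_uniform_count_measure)
  then show ?thesis
    unfolding bernoulli_measure_def using assms(2)
    by (intro measurable_PiM_single') (auto simp: space_uniform_count_measure)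
qed

lemma card_rotation_vimage:
  assumes "M > 0" "F \<subseteq> {0..<M}"
  shows "card {x \<in> {0..<M}. nat ((int x + c) mod int M) \<in> F} = card F"
proof (rule bij_betw_same_card[of "\<lambda>x. nat ((int x + c) mod int M)"],
    rule bij_betw_byWitness[where f' = "\<lambda>y. nat ((int y - c) mod int M)"])
  have "nat ((int (nat ((int x + c) mod int M)) - c) mod int M) = x" if "x < M" for x
    using that assms by (simp add: mod_simps)
  then show "\<forall>x\<in>{x \<in> {0..<M}. nat ((int x + c) mod int M) \<in> F}.
      nat ((int (nat ((int x + c) mod int M)) - c) mod int M) = x"
    by simp
  have *: "nat ((int (nat ((int y - c) mod int M)) + c) mod int M) = y" if "y < M" for y
    using that assms by (simp add: mod_simps)
  have F: "y < M" if "y \<in> F" for y using that assms(2) by auto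
  show "\<forall>y\<in>F. nat ((int (nat ((int y - c) mod int M)) + c) mod int M) = y"
    using * F by blast
  show "(\<lambda>y. nat ((int y - c) mod int M)) ` F \<subseteq> {x \<in> {0..<M}. nat ((int x + c) mod int M) \<in> F}"
  proof
    fix x assume "x \<in> (\<lambda>y. nat ((int y - c) mod int M)) ` F"
    then obtain y where y: "y \<in> F" "x = nat ((int y - c) mod int M)" by blast
    have "x < M" unfolding y(2) using assms(1) by (simp add: nat_less_iff)
    moreover have "nat ((int x + c) mod int M) = y" using *[OF F[OF y(1)]] y(2) by simp
    ultimately show "x \<in> {x \<in> {0..<M}. nat ((int x + c) mod int M) \<in> F}" using y(1) by simp
  qed
qed auto

text \<open>Given the other coordinates, \<open>d t\<close> is uniform, and so is its rotation by an amount which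
  those coordinates determine.\<close>

lemma emeasure_fresh_coordinate:
  fixes G :: "('g \<Rightarrow> nat) \<Rightarrow> int"
  assumes M: "M > 0"
    and A: "A \<in> sets (bernoulli_measure M)"
    and A_fresh: "\<And>d v. d \<in> space (bernoulli_measure M) \<Longrightarrow> v < M \<Longrightarrow> d(t := v) \<in> A \<longleftrightarrow> d \<in> A"
    and G: "G \<in> measurable (bernoulli_measure M) (count_space UNIV)"
    and G_fresh: "\<And>d v. d \<in> space (bernoulli_measure M) \<Longrightarrow> v < M \<Longrightarrow> G (d(t := v)) = G d"
    and F: "F \<subseteq> {0..<M}"
  shows "emeasure (bernoulli_measure M) {d \<in> A. nat ((int (d t) + G d) mod int M) \<in> F} =
    emeasure (bernoulli_measure M) A * ennreal (card F / M)"
proof -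
  let ?u = "uniform_count_measure {0..<M}"
  let ?\<nu> = "bernoulli_measure M :: ('g \<Rightarrow> nat) measure"
  let ?N = "PiM (UNIV - {t}) (\<lambda>_. ?u)"
  let ?f = "\<lambda>(x, X :: 'g \<Rightarrow> nat). X(t := x)"
  interpret u: prob_space ?u
    using M by (intro prob_space_uniform_count_measure) auto
  interpret N: prob_space ?N by (intro prob_space_PiM) unfold_locales
  interpret pair_sigma_finite ?u ?N ..
  have distr: "distr (?u \<Otimes>\<^sub>M ?N) ?\<nu> ?f = ?\<nu>"
    using distr_pair_PiM_eq_PiM[of "UNIV - {t}" "\<lambda>_. ?u" t] u.prob_space_axioms
    by (simp add: bernoulli_measure_def insert_UNIV)
  have "(\<lambda>p. (snd p)(t := fst p)) \<in> measurable (?u \<Otimes>\<^sub>M ?N) (PiM UNIV (\<lambda>_. ?u))"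
    by (rule measurable_fun_upd[where J = "UNIV - {t}"]) auto
  then have f: "?f \<in> measurable (?u \<Otimes>\<^sub>M ?N) ?\<nu>"
    by (simp add: bernoulli_measure_def case_prod_beta)
  \<comment> \<open>disintegrate over the coordinate \<open>t\<close>\<close>
  have slices: "emeasure ?\<nu> B = (\<integral>\<^sup>+Y. emeasure ?u {x \<in> {0..<M}. Y(t := x) \<in> B} \<partial>?N)"
    if "B \<in> sets ?\<nu>" for B
  proof -
    have "emeasure ?\<nu> B = emeasure (?u \<Otimes>\<^sub>M ?N) (?f -` B \<inter> space (?u \<Otimes>\<^sub>M ?N))"
      by (subst distr[symmetric], rule emeasure_distr[OF f that])
    also have "\<dots> = (\<integral>\<^sup>+Y. emeasure ?u ((\<lambda>x. (x, Y)) -` (?f -` B \<inter> space (?u \<Otimes>\<^sub>M ?N))) \<partial>?N)"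
      by (rule emeasure_pair_measure_alt2[OF measurable_sets[OF f that]])
    also have "\<dots> = (\<integral>\<^sup>+Y. emeasure ?u {x \<in> {0..<M}. Y(t := x) \<in> B} \<partial>?N)"
      by (intro nn_integral_cong arg_cong[where f = "emeasure ?u"])
        (auto simp: space_pair_measure space_uniform_count_measure)
    finally show ?thesis .
  qed
  define A' where "A' = {Y. Y(t := 0) \<in> A}"
  have upd: "Y(t := x) \<in> space ?\<nu>" if "Y \<in> space ?N" "x < M" for Y x
    using that by (auto simp: space_bernoulli_measure space_PiM space_uniform_count_measure PiE_iff)
  have A': "Y(t := x) \<in> A \<longleftrightarrow> Y \<in> A'" if "Y \<in> space ?N" "x < M" for Y x
    using A_fresh[OF upd[OF that], of 0] M by (simp add: A'_def)
  have G': "G (Y(t := x)) = G (Y(t := 0))" if "Y \<in> space ?N" "x < M" for Y x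
    using G_fresh[OF upd[OF that], of 0] M by simp
  have [measurable]: "(\<lambda>Y. Y(t := 0)) \<in> measurable ?N ?\<nu>"
    unfolding bernoulli_measure_def using M
    by (intro measurable_fun_upd[where J = "UNIV - {t}"]) (auto simp: space_uniform_count_measure)
  have A'_sets: "A' \<inter> space ?N \<in> sets ?N"
    using measurable_sets[OF \<open>(\<lambda>Y. Y(t := 0)) \<in> measurable ?N ?\<nu>\<close> A] by (simp add: A'_def vimage_def)
  have "emeasure ?\<nu> A = (\<integral>\<^sup>+Y. indicator (A' \<inter> space ?N) Y \<partial>?N)"
    unfolding slices[OF A]
  proof (rule nn_integral_cong)
    fix Y assume Y: "Y \<in> space ?N"
    then have "{x \<in> {0..<M}. Y(t := x) \<in> A} = (if Y \<in> A' then {0..<M} else {})"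
      using A' by auto
    then show "emeasure ?u {x \<in> {0..<M}. Y(t := x) \<in> A} = indicator (A' \<inter> space ?N) Y"
      using Y M by (simp add: emeasure_uniform_count_measure)
  qed
  moreover have B: "{d \<in> A. nat ((int (d t) + G d) mod int M) \<in> F} \<in> sets ?\<nu>"
  proof -
    have "(\<lambda>d. nat ((int (d t) + G d) mod int M)) \<in> measurable ?\<nu> (count_space UNIV)"
      by (rule measurable_count_space_combine[where H = "\<lambda>x y. nat ((int x + y) mod int M)",
        OF measurable_bernoulli_coordinate G])
    then have "{d \<in> space ?\<nu>. nat ((int (d t) + G d) mod int M) \<in> F} \<in> sets ?\<nu>"
      by (rule measurable_sets_Collect) simp
    moreover have "{d \<in> A. nat ((int (d t) + G d) mod int M) \<in> F} =
        A \<inter> {d \<in> space ?\<nu>. nat ((int (d t) + G d) mod int M) \<in> F}"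
      using sets.sets_into_space[OF A] by auto
    ultimately show ?thesis using A by auto
  qed
  have "emeasure ?\<nu> {d \<in> A. nat ((int (d t) + G d) mod int M) \<in> F} =
      (\<integral>\<^sup>+Y. indicator (A' \<inter> space ?N) Y * ennreal (card F / M) \<partial>?N)"
    unfolding slices[OF B]
  proof (rule nn_integral_cong)
    fix Y assume Y: "Y \<in> space ?N"
    define c where "c = G (Y(t := 0))"
    have c: "G (Y(t := x)) = c" if "x < M" for x
      unfolding c_def by (rule G'[OF Y that])
    have "{x \<in> {0..<M}. Y(t := x) \<in> {d \<in> A. nat ((int (d t) + G d) mod int M) \<in> F}} =
        (if Y \<in> A' then {x \<in> {0..<M}. nat ((int x + c) mod int M) \<in> F} else {})"
      using A'[OF Y] c by auto
    moreover have "emeasure ?u {x \<in> {0..<M}. nat ((int x + c) mod int M) \<in> F} = ennreal (card F / M)"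
      using emeasure_uniform_count_measure[of "{0..<M}" "{x \<in> {0..<M}. nat ((int x + c) mod int M) \<in> F}"]
      unfolding card_rotation_vimage[OF M F] card_atLeastLessThan by fastforce
    ultimately show "emeasure ?u {x \<in> {0..<M}. Y(t := x) \<in> {d \<in> A. nat ((int (d t) + G d) mod int M) \<in> F}} =
        indicator (A' \<inter> space ?N) Y * ennreal (card F / M)"
      using Y by (cases "Y \<in> A'") (simp_all only: if_True if_False indicator_simps IntI Int_iff
        mult_1 mult_zero_left emeasure_empty not_False_eq_True simp_thms)
  qed
  ultimately show ?thesis
    using A'_sets by (simp add: nn_integral_multc)
qed

text \<open>The twist is triangular: each coordinate is rotated by an amount that depends only on
  coordinates of strictly higher level. Taking finitely many coordinates in the order of
  descending level, each twisted coordinate is therefore uniform given the previous ones.\<close>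

lemma twist_preserves_bernoulli_measure:
  fixes c :: "'g \<Rightarrow> ('g \<Rightarrow> nat) \<Rightarrow> int" and lev :: "'g \<Rightarrow> int"
  assumes M: "M > 0"
    and meas: "\<And>s. c s \<in> measurable (bernoulli_measure M) (count_space UNIV)"
    and above: "\<And>s t d v. lev t \<le> lev s \<Longrightarrow> c s (d(t := v)) = c s d"
  shows "distr (bernoulli_measure M) (bernoulli_measure M)
      (\<lambda>d s. nat ((int (d s) + c s d) mod int M)) = bernoulli_measure M"
    (is "distr ?\<nu> ?\<nu> ?T = _")
proof -
  let ?u = "\<lambda>_ :: 'g. uniform_count_measure {0..<M}"
  interpret product_prob_space ?u UNIV
    using M by (intro product_prob_spaceI prob_space_uniform_count_measure) auto
  have T1: "(\<lambda>d. ?T d s) \<in> measurable ?\<nu> (count_space UNIV)" for s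
    by (rule measurable_count_space_combine[where H = "\<lambda>x y. nat ((int x + y) mod int M)",
        OF measurable_bernoulli_coordinate meas])
  then have T: "?T \<in> measurable ?\<nu> ?\<nu>"
    using M by (intro measurable_into_bernoulli_measure) (auto simp: nat_less_iff)
  have "distr ?\<nu> ?\<nu> ?T = PiM UNIV ?u"
  proof (rule PiM_eq)
    show "sets (distr ?\<nu> ?\<nu> ?T) = sets (PiM UNIV ?u)"
      by (simp add: bernoulli_measure_def)
    fix J :: "'g set" and F
    assume J: "finite J" and F0: "\<And>j. j \<in> J \<Longrightarrow> F j \<in> sets (?u j)"
    then have F: "F j \<subseteq> {0..<M}" if "j \<in> J" for j
      using that by (auto simp: sets_uniform_count_measure)
    let ?C = "\<lambda>J. {d \<in> space ?\<nu>. \<forall>j\<in>J. ?T d j \<in> F j}"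
    have C: "?C J \<in> sets ?\<nu>" if "finite J" for J
      using that by (intro sets.sets_Collect_finite_All measurable_sets_Collect[OF T1]) simp_all
    \<comment> \<open>peel off the coordinates of \<open>J\<close> from the lowest level upwards: nothing that the remaining
      coordinates of the twisted point depend on involves the coordinate at the lowest level\<close>
    have "emeasure ?\<nu> (?C J) = (\<Prod>j\<in>J. ennreal (card (F j) / M))"
      using J F
    proof (induction J rule: finite_ranking_induct[where f = "\<lambda>t. - lev t"])
      case empty
      then show ?case
        using prob_space.emeasure_space_1[OF prob_space_bernoulli_measure[OF M]] by simp
    next
      case (insert t J)
      show ?case
      proof (cases "t \<in> J")
        case False
        have "?C (insert t J) = {d \<in> ?C J. nat ((int (d t) + c t d) mod int M) \<in> F t}" by auto
        also have "emeasure ?\<nu> \<dots> = emeasure ?\<nu> (?C J) * ennreal (card (F t) / M)"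
        proof (rule emeasure_fresh_coordinate[OF M C[OF insert.hyps(1)]])
          fix d v assume d: "d \<in> space ?\<nu>" "v < M"
          have "?T (d(t := v)) j = ?T d j" if "j \<in> J" for j
            using that False above[of t j d v] insert.hyps(2)[OF that] by auto
          then show "d(t := v) \<in> ?C J \<longleftrightarrow> d \<in> ?C J"
            using d by (auto simp: space_bernoulli_measure)
        qed (use insert.prems above meas in auto)
        finally show ?thesis using insert.IH insert.prems insert.hyps(1) False by (simp add: mult.commute)
      qed (use insert.IH insert.prems in \<open>simp add: insert_absorb\<close>)
    qed
    moreover have "?T -` prod_emb UNIV ?u J (Pi\<^sub>E J F) \<inter> space ?\<nu> = ?C J"
      using M by (auto simp: prod_emb_def space_uniform_count_measure PiE_iff nat_less_iff)
    moreover have "prod_emb UNIV ?u J (Pi\<^sub>E J F) \<in> sets ?\<nu>"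
      unfolding bernoulli_measure_def using J F0 by (intro sets_PiM_I) auto
    ultimately show "emeasure (distr ?\<nu> ?\<nu> ?T) (prod_emb UNIV ?u J (Pi\<^sub>E J F)) =
        (\<Prod>j\<in>J. emeasure (?u j) (F j))"
      using F by (simp add: emeasure_distr[OF T] emeasure_uniform_count_measure)
  qed
  then show ?thesis by (simp add: bernoulli_measure_def)
qed

section \<open>Expansions in the inverse of \<open>M - a - b\<close>\<close>

lemma principal_algebraic_two_generators:
  fixes a b :: "'g :: group_add"
  assumes "a \<noteq> b" "a \<noteq> 0" "b \<noteq> 0" "M > 0"
  shows "principal_algebraic (of_nat M - Poly_Mapping.single a 1 - Poly_Mapping.single b 1) =
    {x. \<forall>t. int_scale (int M) (x t) = x (t + a) + x (t + b)}"
proof -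
  let ?f = "of_nat M - Poly_Mapping.single a 1 - Poly_Mapping.single b 1 :: 'g \<Rightarrow>\<^sub>0 int"
  have lookup: "Poly_Mapping.lookup ?f s = (if s = 0 then int M else if s = a then - 1 else if s = b then - 1 else 0)" for s
    using assms by (auto simp: lookup_minus lookup_single lookup_of_nat when_def)
  have keys: "Poly_Mapping.keys ?f = {0, a, b}"
    using assms by (auto simp: in_keys_iff lookup simp del: lookup_minus split: if_splits)
  have "(\<Sum>s\<in>Poly_Mapping.keys ?f. int_scale (Poly_Mapping.lookup ?f s) (x (t + s))) =
      int_scale (int M) (x t) - (x (t + a) + x (t + b))" for x :: "'g \<Rightarrow> circle" and t
    unfolding keys using assms by (simp add: lookup int_scale_minus_one del: lookup_minus)
  then show ?thesis
    by (simp add: principal_algebraic_def)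
qed

locale two_generators =
  fixes h :: "'g :: {group_add, countable} \<Rightarrow> int" and a b :: 'g and M :: nat
  assumes hom: "\<And>s t. h (s + t) = h s + h t" and ha: "h a = 1" and hb: "h b = 1" and M3: "M \<ge> 3"
begin

lemma h_add_generator [simp]: "h (t + a) = h t + 1" "h (t + b) = h t + 1"
  by (simp_all add: hom ha hb)

lemma M_pos [simp]: "M > 0" using M3 by simp

abbreviation words :: "('g \<Rightarrow> nat) set" where
  "words \<equiv> {d. \<forall>t. d t < M}"

abbreviation \<nu> :: "('g \<Rightarrow> nat) measure" where
  "\<nu> \<equiv> bernoulli_measure M"

text \<open>The \<open>n\<close>-th layer is \<open>M\<^sup>-\<^sup>n\<^sup>-\<^sup>1\<close> times the sum of \<open>d (t + w)\<close> over all words \<open>w\<close> of length \<open>n\<close>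
  in \<open>a\<close> and \<open>b\<close>, which is the contribution of \<open>(a + b)\<^sup>n / M\<^sup>n\<^sup>+\<^sup>1\<close> to the inverse of \<open>M - a - b\<close>.\<close>

primrec layer :: "nat \<Rightarrow> ('g \<Rightarrow> nat) \<Rightarrow> 'g \<Rightarrow> real" where
  "layer 0 d t = d t / M"
| "layer (Suc n) d t = (layer n d (t + a) + layer n d (t + b)) / M"

definition expansion :: "('g \<Rightarrow> nat) \<Rightarrow> 'g \<Rightarrow> real" where
  "expansion d t = suminf (\<lambda>n. layer n d t)"

lemma layer_nonneg: "layer n d t \<ge> 0"
  by (induction n arbitrary: t) auto

lemma layer_le: "d \<in> words \<Longrightarrow> layer n d t \<le> (1 - 1 / M) * (2 / M) ^ n"
proof (induction n arbitrary: t)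
  case 0
  then have "d t < M" by simp
  then have "real (d t) \<le> real M - 1" by linarith
  then have "real (d t) / M \<le> (real M - 1) / M" by (rule divide_right_mono) simp
  then show ?case using M_pos by (simp add: diff_divide_distrib)
next
  case (Suc n)
  have "layer (Suc n) d t \<le> ((1 - 1 / M) * (2 / M) ^ n + (1 - 1 / M) * (2 / M) ^ n) / M"
    unfolding layer.simps using Suc by (intro divide_right_mono add_mono) auto
  also have "\<dots> = (1 - 1 / M) * (2 / M) ^ Suc n" by (simp add: algebra_simps)
  finally show ?case .
qed

lemma layer_bound_sums: "(\<lambda>n. (1 - 1 / M) * (2 / M) ^ n) sums ((real M - 1) / (real M - 2))"
proof -
  have "(\<lambda>n. (2 / real M) ^ n) sums (1 / (1 - 2 / real M))"
    using M3 by (intro geometric_sums) simp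
  moreover have "1 - 2 / real M = (real M - 2) / M" "1 - 1 / real M = (real M - 1) / M"
    using M3 by (simp_all add: diff_divide_distrib)
  ultimately show ?thesis
    using sums_mult[of "\<lambda>n. (2 / real M) ^ n" "1 / (1 - 2 / real M)" "1 - 1 / M"] M_pos by simp
qed

lemma summable_layer: "d \<in> words \<Longrightarrow> summable (\<lambda>n. layer n d t)"
  by (rule summable_comparison_test'[OF sums_summable[OF layer_bound_sums], of 0])
    (simp add: layer_nonneg layer_le)

lemma expansion_nonneg: "d \<in> words \<Longrightarrow> expansion d t \<ge> 0"
  unfolding expansion_def by (rule suminf_nonneg[OF summable_layer layer_nonneg])

text \<open>The exact supremum is \<open>(M - 1) / (M - 2)\<close>. The bound 2, attained for \<open>M = 3\<close>, is what
  limits the integer differences of two expansions.\<close>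

lemma expansion_le: "d \<in> words \<Longrightarrow> expansion d t \<le> 2"
proof -
  assume d: "d \<in> words"
  have "expansion d t \<le> (real M - 1) / (real M - 2)"
    unfolding expansion_def sums_unique[OF layer_bound_sums]
    by (rule suminf_le[OF layer_le[OF d] summable_layer[OF d] sums_summable[OF layer_bound_sums]])
  also have "\<dots> \<le> 2" using M3 by (simp add: pos_divide_le_eq)
  finally show ?thesis .
qed

lemma expansion_rec:
  assumes "d \<in> words"
  shows "M * expansion d t = d t + expansion d (t + a) + expansion d (t + b)"
proof -
  note s = summable_layer[OF assms]
  have "expansion d t = d t / M + suminf (\<lambda>n. layer (Suc n) d t)"
    using suminf_split_head[OF s, of t] by (simp add: expansion_def)
  also have "suminf (\<lambda>n. layer (Suc n) d t) = (expansion d (t + a) + expansion d (t + b)) / M"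
    unfolding expansion_def layer.simps suminf_add[OF s s]
    by (rule suminf_divide[OF summable_add[OF s s]])
  finally show ?thesis using M_pos by (simp add: field_simps)
qed

lemma expansion_cong_above:
  assumes "\<And>s. h s \<ge> h t \<Longrightarrow> d s = d' s"
  shows "expansion d t = expansion d' t"
proof -
  have "layer n d s = layer n d' s" if "h s \<ge> h t" for n s
    using that by (induction n arbitrary: s) (auto simp: assms)
  then show ?thesis by (simp add: expansion_def)
qed

lemma continuous_on_expansion: "continuous_on words (\<lambda>d. expansion d t)"
proof (rule uniform_limit_theorem)
  show "uniform_limit words (\<lambda>n d. \<Sum>i<n. layer i d t) (\<lambda>d. expansion d t) sequentially"
    unfolding expansion_def
    by (rule Weierstrass_m_test[OF _ sums_summable[OF layer_bound_sums]])
      (simp add: layer_nonneg layer_le)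
  have "continuous_on words (\<lambda>d. layer i d s)" for i s
  proof (induction i arbitrary: s)
    case 0
    have "continuous_on words (\<lambda>d. d s)"
      by (rule continuous_on_product_then_coordinatewise[OF continuous_on_id])
    then show ?case by (auto intro!: continuous_intros)
  qed (auto intro!: continuous_intros)
  then show "\<forall>\<^sub>F n in sequentially. continuous_on words (\<lambda>d. \<Sum>i<n. layer i d t)"
    by (intro always_eventually allI continuous_on_sum)
qed simp

lemma measurable_expansion: "(\<lambda>d. expansion d t) \<in> borel_measurable \<nu>"
proof -
  have "(\<lambda>d. layer n d s) \<in> borel_measurable \<nu>" for n s
  proof (induction n arbitrary: s)
    case 0
    have "(\<lambda>d. real (d s)) \<in> borel_measurable \<nu>"
      by (rule measurable_compose[OF measurable_bernoulli_coordinate]) simp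
    then show ?case by simp
  qed simp
  then show ?thesis unfolding expansion_def by (rule borel_measurable_suminf)
qed

definition coding :: "('g \<Rightarrow> nat) \<Rightarrow> 'g \<Rightarrow> circle" where
  "coding d = (\<lambda>t. to_circle (expansion d t))"

definition X :: "('g \<Rightarrow> circle) set" where
  "X = {x. \<forall>t. int_scale (int M) (x t) = x (t + a) + x (t + b)}"

lemma coding_in_X:
  assumes "d \<in> words"
  shows "coding d \<in> X"
proof -
  have "to_circle (M * expansion d t) = to_circle (expansion d (t + a) + expansion d (t + b))" for t
    unfolding expansion_rec[OF assms] to_circle_eq_iff by simp
  then show ?thesis by (simp add: X_def coding_def int_scale_to_circle to_circle_add)
qed

lemma continuous_on_coding: "continuous_on words coding"
  unfolding coding_def
  by (intro continuous_on_coordinatewise_then_product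
      continuous_on_compose2[OF continuous_on_to_circle continuous_on_expansion] subset_UNIV)

lemma measurable_coding: "coding \<in> borel_measurable \<nu>"
proof (rule measurable_coordinatewise_then_product)
  have "to_circle \<in> borel_measurable borel"
    using continuous_on_to_circle by (rule borel_measurable_continuous_onI)
  then show "(\<lambda>d. coding d t) \<in> borel_measurable \<nu>" for t
    unfolding coding_def by (rule measurable_compose[OF measurable_expansion])
qed

lemma shift_in_words: "d \<in> words \<Longrightarrow> shift_action s d \<in> words"
  by (simp add: shift_action_def)

lemma coding_shift: "coding (shift_action s d) = shift_action s (coding d)"
proof -
  have "layer n (shift_action s d) t = layer n d (- s + t)" for n t
    by (induction n arbitrary: t) (simp_all add: shift_action_def add.assoc)
  then show ?thesis by (simp add: coding_def expansion_def shift_action_def)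
qed

section \<open>Points with several expansions\<close>

text \<open>A pattern that sustains itself upwards for \<open>n\<close> levels: the digit \<open>p\<close> needs one of its two
  successors, the digit \<open>q\<close> needs both. With \<open>(p, q) = (M - 1, M - 2)\<close> this is forced by a positive
  difference of expansions, with \<open>(p, q) = (0, 1)\<close> by a negative one.\<close>

primrec percolates :: "nat \<Rightarrow> nat \<Rightarrow> nat \<Rightarrow> ('g \<Rightarrow> nat) \<Rightarrow> 'g \<Rightarrow> bool" where
  "percolates p q 0 d t = True"
| "percolates p q (Suc n) d t =
    (d t = p \<and> (percolates p q n d (t + a) \<or> percolates p q n d (t + b)) \<or>
     d t = q \<and> percolates p q n d (t + a) \<and> percolates p q n d (t + b))"

lemma percolates_cong_above:
  assumes "\<And>s. h s \<ge> h t \<Longrightarrow> d s = d' s"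
  shows "percolates p q n d t = percolates p q n d' t"
proof -
  have "percolates p q n d s = percolates p q n d' s" if "h s \<ge> h t" for s
    using that by (induction n arbitrary: s) (auto simp: assms)
  then show ?thesis by simp
qed

lemma percolates_shift: "percolates p q n (shift_action s d) t = percolates p q n d (- s + t)"
  by (induction n arbitrary: t) (simp_all add: shift_action_def add.assoc)

lemma percolates_reflect:
  assumes "d \<in> words" "p < M" "q < M"
  shows "percolates p q n (\<lambda>t. M - 1 - d t) t = percolates (M - 1 - p) (M - 1 - q) n d t"
proof (induction n arbitrary: t)
  case (Suc n)
  have "d t < M" using assms by simp
  then have "M - 1 - d t = p \<longleftrightarrow> d t = M - 1 - p" "M - 1 - d t = q \<longleftrightarrow> d t = M - 1 - q"
    using assms by linarith+
  with Suc show ?case by simp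
qed simp

text \<open>Write the recursion as \<open>z (t + a) + z (t + b) = M z t - (d t - d' t)\<close>, where the last
  difference is at most \<open>d t \<le> M - 1\<close>. If \<open>z t = 2\<close>, the left-hand side is at least \<open>M + 1\<close>, which
  forces \<open>z\<close> to be 2 at both successors and \<open>d t = M - 1\<close>. Once the value 2 is excluded, \<open>z t = 1\<close>
  forces \<open>z (t + a) + z (t + b) \<ge> M - d t\<close> with both summands at most 1.\<close>

lemma percolates_if_difference_positive:
  fixes z :: "'g \<Rightarrow> int"
  assumes d: "d \<in> words" "d' \<in> words"
    and rec: "\<And>t. int M * z t = int (d t) - int (d' t) + z (t + a) + z (t + b)"
    and le2: "\<And>t. z t \<le> 2"
    and pos: "z t0 > 0"
  shows "\<exists>t. \<forall>n. percolates (M - 1) (M - 2) n d t"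
proof (cases "\<exists>t. z t = 2")
  case True
  then obtain t where t: "z t = 2" by blast
  have "percolates (M - 1) (M - 2) n d s" if "z s = 2" for n s
    using that
  proof (induction n arbitrary: s)
    case (Suc n)
    have "d s < M" "d' s < M" using d by simp_all
    then have "z (s + a) = 2" "z (s + b) = 2" "d s = M - 1"
      using rec[of s] le2[of "s + a"] le2[of "s + b"] M3 unfolding Suc.prems by linarith+
    with Suc show ?case by simp
  qed simp
  with t show ?thesis by blast
next
  case False
  then have le1: "z t \<le> 1" for t using le2[of t] by (metis linorder_not_le order_antisym zle_add1_eq_le one_add_one)
  have "percolates (M - 1) (M - 2) n d s" if "z s = 1" for n s
    using that
  proof (induction n arbitrary: s)
    case (Suc n)
    have lt: "d s < M" "d' s < M" using d by simp_all
    note r = rec[of s, unfolded Suc.prems] le1[of "s + a"] le1[of "s + b"]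
    show ?case
    proof (cases "d s = M - 1")
      case True
      have "z (s + a) = 1 \<or> z (s + b) = 1" using r lt by linarith
      with True Suc show ?thesis by auto
    next
      case False
      then have "z (s + a) = 1" "z (s + b) = 1" "d s = M - 2" using r lt by linarith+
      with Suc show ?thesis by simp
    qed
  qed simp
  moreover have "z t0 = 1" using pos le1[of t0] by simp
  ultimately show ?thesis by blast
qed

definition exceptional :: "('g \<Rightarrow> nat) set" where
  "exceptional = {d \<in> words. \<exists>t. (\<forall>n. percolates (M - 1) (M - 2) n d t) \<or> (\<forall>n. percolates 0 1 n d t)}"

text \<open>The difference of two expansions of the same point is integer valued; it is positive nowhere
  by \<open>percolates_if_difference_positive\<close> for \<open>d\<close>, and negative nowhere by the same lemma for the
  reflected digits \<open>M - 1 - d t\<close>. Only one of the two configurations has to be unexceptional, so a point with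
  an unexceptional expansion has no other expansion.\<close>

lemma coding_unique:
  assumes d: "d \<in> words" "d \<notin> exceptional" and d': "d' \<in> words" and eq: "coding d = coding d'"
  shows "d = d'"
proof -
  have "\<exists>z :: int. expansion d t - expansion d' t = of_int z" for t
    using fun_cong[OF eq, of t] by (auto simp: coding_def to_circle_eq_iff Ints_def)
  then obtain z :: "'g \<Rightarrow> int" where z: "expansion d t - expansion d' t = of_int (z t)" for t
    by metis
  have "real_of_int (int M * z t) = real_of_int (int (d t) - int (d' t) + z (t + a) + z (t + b))" for t
    using expansion_rec[OF d(1), of t] expansion_rec[OF d', of t]
    by (simp add: z[symmetric] algebra_simps)
  then have rec: "int M * z t = int (d t) - int (d' t) + z (t + a) + z (t + b)" for t
    by (simp only: of_int_eq_iff)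
  have abs: "\<bar>real_of_int (z t)\<bar> \<le> 2" for t
    using expansion_nonneg[OF d(1), of t] expansion_nonneg[OF d', of t]
      expansion_le[OF d(1), of t] expansion_le[OF d', of t] unfolding z[symmetric] by linarith
  have bound: "z t \<le> 2" "- z t \<le> 2" for t
  proof -
    have "real_of_int (z t) \<le> real_of_int 2" "real_of_int (- z t) \<le> real_of_int 2"
      using abs[of t] by (simp_all add: abs_le_iff)
    then show "z t \<le> 2" "- z t \<le> 2" by (simp_all only: of_int_le_iff)
  qed
  have "z t \<le> 0" for t
  proof (rule ccontr)
    assume "\<not> z t \<le> 0"
    then have "\<exists>t. \<forall>n. percolates (M - 1) (M - 2) n d t"
      using percolates_if_difference_positive[OF d(1) d' rec bound(1), of t] by simp
    then show False using d unfolding exceptional_def by blast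
  qed
  moreover have "- z t \<le> 0" for t
  proof (rule ccontr)
    assume "\<not> - z t \<le> 0"
    then have pos: "- z t > 0" by simp
    let ?r = "\<lambda>d t. M - 1 - d t :: nat"
    have M1_less: "M - 1 < M" and M2_less: "M - 2 < M" using M3 by linarith+
    have "\<exists>t. \<forall>n. percolates (M - 1) (M - 2) n (?r d) t"
    proof (rule percolates_if_difference_positive[where z = "\<lambda>t. - z t" and ?t0.0 = t and d' = "?r d'"])
      show "int M * - z t = int (?r d t) - int (?r d' t) + - z (t + a) + - z (t + b)" for t
      proof -
        have "d t < M" "d' t < M" using d(1) d' by simp_all
        then have "int (?r d t) - int (?r d' t) = int (d' t) - int (d t)" by linarith
        then show ?thesis using rec[of t] by simp
      qed
      show "?r d \<in> words" "?r d' \<in> words" using M_pos by (simp_all add: less_imp_diff_less)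
    qed (rule bound(2) pos)+
    then have "\<exists>t. \<forall>n. percolates 0 1 n d t"
      using M3 unfolding percolates_reflect[OF d(1) M1_less M2_less] by simp
    then show False using d unfolding exceptional_def by blast
  qed
  ultimately have "z t = 0" for t by (simp add: order_antisym)
  then have "d t = d' t" for t using rec[of t] by simp
  then show ?thesis by blast
qed

lemma closed_percolates: "closed {d. percolates p q n d t}"
proof (induction n arbitrary: t)
  case (Suc n)
  have "closed {d :: 'g \<Rightarrow> nat. d t = c}" for c
    by (intro closed_Collect_eq continuous_on_product_coordinates continuous_on_const)
  with Suc show ?case by (simp add: closed_Collect_disj closed_Collect_conj)
qed simp

lemma percolates_sets: "{d \<in> words. percolates p q n d t} \<in> sets \<nu>"
proof (induction n arbitrary: t)
  case 0
  show ?case using sets.top[of \<nu>] by (simp add: space_bernoulli_measure)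
next
  case (Suc n)
  have "{d \<in> space \<nu>. d t = c} \<in> sets \<nu>" for c
    by (rule measurable_sets_Collect[OF measurable_bernoulli_coordinate]) simp
  then have "{d \<in> words. d t = c} \<in> sets \<nu>" for c
    by (simp add: space_bernoulli_measure)
  then have "({d \<in> words. d t = p} \<inter> ({d \<in> words. percolates p q n d (t + a)} \<union> {d \<in> words. percolates p q n d (t + b)})) \<union>
     ({d \<in> words. d t = q} \<inter> ({d \<in> words. percolates p q n d (t + a)} \<inter> {d \<in> words. percolates p q n d (t + b)})) \<in> sets \<nu>"
    (is "?S \<in> _") using Suc by (intro sets.Un sets.Int)
  moreover have "?S = {d \<in> words. percolates p q (Suc n) d t}" by auto
  ultimately show ?case by simp
qed

text \<open>Let \<open>A\<close> and \<open>B\<close> be the events that the pattern extends from \<open>t + a\<close> and from \<open>t + b\<close>. They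
  may be dependent, since words in \<open>a\<close> and \<open>b\<close> need not be distinct elements of the group, but both
  are independent of \<open>d t\<close>. Hence the probability at \<open>t\<close> is
  \<open>(P(A \<union> B) + P(A \<inter> B)) / M = (P(A) + P(B)) / M\<close>.\<close>

lemma emeasure_percolates:
  assumes "p \<noteq> q" "p < M" "q < M"
  shows "emeasure \<nu> {d \<in> words. percolates p q n d t} = ennreal ((2 / M) ^ n)"
proof (induction n arbitrary: t)
  case 0
  show ?case
    using prob_space.emeasure_space_1[OF prob_space_bernoulli_measure[OF M_pos]]
    by (simp add: space_bernoulli_measure)
next
  case (Suc n)
  let ?A = "{d \<in> words. percolates p q n d (t + a)}" and ?B = "{d \<in> words. percolates p q n d (t + b)}"
  have fresh: "emeasure \<nu> {d \<in> C. d t = c} = emeasure \<nu> C * ennreal (1 / M)"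
    if "C \<in> sets \<nu>" "c < M" "\<And>d v. d \<in> words \<Longrightarrow> v < M \<Longrightarrow> d(t := v) \<in> C \<longleftrightarrow> d \<in> C" for C c
  proof -
    have "{d \<in> C. d t = c} = {d \<in> C. nat ((int (d t) + 0) mod int M) \<in> {c}}"
    proof (rule Collect_cong, rule conj_cong[OF refl])
      fix d assume "d \<in> C"
      then have "d t < M"
        using sets.sets_into_space[OF that(1)] by (auto simp: space_bernoulli_measure)
      then show "d t = c \<longleftrightarrow> nat ((int (d t) + 0) mod int M) \<in> {c}" by simp
    qed
    also have "emeasure \<nu> \<dots> = emeasure \<nu> C * ennreal (card {c} / M)"
      by (rule emeasure_fresh_coordinate[OF M_pos that(1)])
        (use that(2,3) in \<open>simp_all add: space_bernoulli_measure\<close>)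
    finally show ?thesis by simp
  qed
  have inv: "percolates p q n (d(t := v)) (t + a) = percolates p q n d (t + a)"
    "percolates p q n (d(t := v)) (t + b) = percolates p q n d (t + b)" for d v
    by (intro percolates_cong_above; auto)+
  have words_upd: "(d(t := v)) s < M" if "\<forall>t. d t < M" "v < M" for d v s
    using that by simp
  have split: "{d \<in> words. percolates p q (Suc n) d t} = {d \<in> ?A \<union> ?B. d t = p} \<union> {d \<in> ?A \<inter> ?B. d t = q}"
    by auto
  have "emeasure \<nu> {d \<in> words. percolates p q (Suc n) d t} = emeasure \<nu> {d \<in> ?A \<union> ?B. d t = p} + emeasure \<nu> {d \<in> ?A \<inter> ?B. d t = q}"
    unfolding split
  proof (rule plus_emeasure[symmetric])
    have *: "{d \<in> C. d t = c} \<in> sets \<nu>" if "C \<in> sets \<nu>" for C c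
    proof -
      have "{d \<in> C. d t = c} = C \<inter> {d \<in> space \<nu>. d t = c}"
        using sets.sets_into_space[OF that] by auto
      moreover have "{d \<in> space \<nu>. d t = c} \<in> sets \<nu>"
        by (rule measurable_sets_Collect[OF measurable_bernoulli_coordinate]) simp
      ultimately show ?thesis using that by (simp only: sets.Int)
    qed
    show "{d \<in> ?A \<union> ?B. d t = p} \<in> sets \<nu>" "{d \<in> ?A \<inter> ?B. d t = q} \<in> sets \<nu>"
      by (rule *[OF sets.Un[OF percolates_sets percolates_sets]], rule *[OF sets.Int[OF percolates_sets percolates_sets]])
    show "{d \<in> ?A \<union> ?B. d t = p} \<inter> {d \<in> ?A \<inter> ?B. d t = q} = {}"
      using assms(1) by blast
  qed
  also have "\<dots> = emeasure \<nu> (?A \<union> ?B) * ennreal (1 / M) + emeasure \<nu> (?A \<inter> ?B) * ennreal (1 / M)"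
  proof (rule arg_cong2[where f = "(+)"])
    have inv': "d(t := v) \<in> ?A \<longleftrightarrow> d \<in> ?A" "d(t := v) \<in> ?B \<longleftrightarrow> d \<in> ?B"
      if "d \<in> words" "v < M" for d v
      using that by (simp_all add: inv words_upd del: fun_upd_apply)
    show "emeasure \<nu> {d \<in> ?A \<union> ?B. d t = p} = emeasure \<nu> (?A \<union> ?B) * ennreal (1 / M)"
      by (rule fresh[OF sets.Un[OF percolates_sets percolates_sets] assms(2)]) (simp only: Un_iff inv')
    show "emeasure \<nu> {d \<in> ?A \<inter> ?B. d t = q} = emeasure \<nu> (?A \<inter> ?B) * ennreal (1 / M)"
      by (rule fresh[OF sets.Int[OF percolates_sets percolates_sets] assms(3)]) (simp only: Int_iff inv')
  qed
  also have "\<dots> = (emeasure \<nu> ?A + emeasure \<nu> ?B) * ennreal (1 / M)"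
    unfolding emeasure_Un_Int[OF percolates_sets percolates_sets] distrib_right ..
  also have "\<dots> = ennreal ((2 / M) ^ Suc n)"
  proof -
    let ?x = "(2 / real M) ^ n"
    have "ennreal ?x + ennreal ?x = ennreal (?x + ?x)" by (rule ennreal_plus[symmetric]) simp_all
    moreover have "ennreal (?x + ?x) * ennreal (1 / M) = ennreal ((?x + ?x) * (1 / M))"
      by (rule ennreal_mult[symmetric]) simp_all
    ultimately show ?thesis unfolding Suc by simp
  qed
  finally show ?case .
qed

lemma null_percolates:
  assumes "p \<noteq> q" "p < M" "q < M"
  shows "{d \<in> words. \<forall>n. percolates p q n d t} \<in> null_sets \<nu>"
proof -
  have eq: "{d \<in> words. \<forall>n. percolates p q n d t} = (\<Inter>n. {d \<in> words. percolates p q n d t})" by auto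
  have sets: "{d \<in> words. \<forall>n. percolates p q n d t} \<in> sets \<nu>"
    unfolding eq by (intro sets.countable_INT image_subsetI percolates_sets UNIV_not_empty)
  have "emeasure \<nu> {d \<in> words. \<forall>n. percolates p q n d t} \<le> ennreal ((2 / M) ^ n)" for n
    unfolding emeasure_percolates[OF assms, symmetric, of n t] by (rule emeasure_mono[OF _ percolates_sets]) auto
  moreover have "(\<lambda>n. ennreal ((2 / M) ^ n)) \<longlonglongrightarrow> ennreal 0"
    using M3 by (intro tendsto_ennrealI LIMSEQ_realpow_zero) auto
  ultimately have "emeasure \<nu> {d \<in> words. \<forall>n. percolates p q n d t} \<le> ennreal 0"
    by (intro LIMSEQ_le_const) auto
  with sets show ?thesis by (simp add: null_sets_def)
qed

lemma null_exceptional: "exceptional \<in> null_sets \<nu>"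
proof -
  have "exceptional = (\<Union>t. {d \<in> words. \<forall>n. percolates (M - 1) (M - 2) n d t} \<union> {d \<in> words. \<forall>n. percolates 0 1 n d t})"
    by (auto simp: exceptional_def)
  moreover have "\<dots> \<in> null_sets \<nu>"
    using M3 by (intro null_sets_UN' null_sets.Un null_percolates) auto
  ultimately show ?thesis by simp
qed

section \<open>The law of the coding is Haar measure\<close>

lemma X_add: "x \<in> X \<Longrightarrow> y \<in> X \<Longrightarrow> x + y \<in> X"
  by (simp add: X_def int_scale_add ac_simps)

lemma X_minus: "x \<in> X \<Longrightarrow> - x \<in> X"
  using int_scale_diff[of _ 0 "x _"] int_scale_diff[of _ 0 0] by (simp add: X_def)

text \<open>Let \<open>y\<close> be the real lift of the translating point and \<open>c t = M y\<^sub>t - y\<^sub>t\<^sub>+\<^sub>a - y\<^sub>t\<^sub>+\<^sub>b\<close>, an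
  integer. Adding \<open>y\<close> below a cutoff level means adding the digits \<open>c\<close> to \<open>d\<close>; as in ordinary
  addition, digits are reduced modulo \<open>M\<close> and the quotient, here with a minus sign, is carried
  to the next level, which is the one below. The number \<open>m\<close> counts the levels between \<open>t\<close> and the cutoff.\<close>

primrec carry :: "('g \<Rightarrow> int) \<Rightarrow> nat \<Rightarrow> ('g \<Rightarrow> nat) \<Rightarrow> 'g \<Rightarrow> int" where
  "carry c 0 d t = 0"
| "carry c (Suc m) d t =
    - ((int (d t) + (c t - carry c m d (t + a) - carry c m d (t + b))) div int M)"

text \<open>The effect at \<open>t\<close>, which lies \<open>m\<close> levels below the cutoff, of not adding \<open>y\<close> at and above
  the cutoff.\<close>

primrec decay :: "('g \<Rightarrow> real) \<Rightarrow> nat \<Rightarrow> 'g \<Rightarrow> real" where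
  "decay y 0 t = y t"
| "decay y (Suc m) t = (decay y m (t + a) + decay y m (t + b)) / M"

text \<open>The points \<open>t + a\<close> and \<open>t + b\<close> are one level nearer to the cutoff \<open>n\<close> than \<open>t\<close>, hence
  the index \<open>nat (n - h t) - 1\<close>.\<close>

definition twist :: "('g \<Rightarrow> int) \<Rightarrow> int \<Rightarrow> 'g \<Rightarrow> ('g \<Rightarrow> nat) \<Rightarrow> int" where
  "twist c n t d = (if h t \<ge> n then 0
    else c t - carry c (nat (n - h t) - 1) d (t + a) - carry c (nat (n - h t) - 1) d (t + b))"

definition twisted :: "('g \<Rightarrow> int) \<Rightarrow> int \<Rightarrow> ('g \<Rightarrow> nat) \<Rightarrow> 'g \<Rightarrow> nat" where
  "twisted c n d = (\<lambda>t. nat ((int (d t) + twist c n t d) mod int M))"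

lemma twisted_in_words: "twisted c n d \<in> words"
  using M_pos by (simp add: twisted_def nat_less_iff)

lemma carry_cong_above:
  assumes "\<And>s. h s \<ge> h t \<Longrightarrow> d s = d' s"
  shows "carry c m d t = carry c m d' t"
proof -
  have "carry c m d s = carry c m d' s" if "h s \<ge> h t" for s
    using that by (induction m arbitrary: s) (simp_all add: assms)
  then show ?thesis by simp
qed

lemma twist_upd:
  assumes "h t \<le> h s"
  shows "twist c n s (d(t := v)) = twist c n s d"
proof -
  have "carry c m (d(t := v)) (s + a) = carry c m d (s + a)"
    "carry c m (d(t := v)) (s + b) = carry c m d (s + b)" for m
    using assms by (intro carry_cong_above; auto)+
  then show ?thesis by (simp add: twist_def)
qed

lemma measurable_twist: "twist c n t \<in> measurable \<nu> (count_space UNIV)"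
proof -
  have carry: "(\<lambda>d. carry c m d s) \<in> measurable \<nu> (count_space UNIV)" for m s
  proof (induction m arbitrary: s)
    case (Suc m)
    have "(\<lambda>d. carry c m d (s + a) + carry c m d (s + b)) \<in> measurable \<nu> (count_space UNIV)"
      by (rule measurable_count_space_combine[where H = "(+)", OF Suc Suc])
    from measurable_count_space_combine[where H = "\<lambda>x k. - ((int x + (c s - k)) div int M)",
        OF measurable_bernoulli_coordinate this]
    show ?case by (simp add: diff_diff_eq)
  qed simp
  have "(\<lambda>d. twist c n t d) \<in> measurable \<nu> (count_space UNIV)"
  proof (cases "h t \<ge> n")
    case False
    then show ?thesis
      unfolding twist_def
      using measurable_count_space_combine[where H = "\<lambda>x y. c t - x - y", OF carry carry] by simp
  qed (simp add: twist_def)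
  then show ?thesis by simp
qed

lemma distr_twisted: "distr \<nu> \<nu> (twisted c n) = \<nu>"
  unfolding twisted_def
  by (rule twist_preserves_bernoulli_measure[where lev = h, OF M_pos measurable_twist twist_upd])

text \<open>At and above the cutoff both sides are \<open>expansion d t\<close>, because expansions only look upwards.
  Below it, both sides satisfy the same recursion: in that of the right-hand side, the new digit
  is \<open>d t + c t\<close> with the carries from above subtracted and \<open>M\<close> times the new carry added.
  Modulo 1 the carry disappears.\<close>

lemma expansion_twisted:
  assumes d: "d \<in> words"
    and c: "\<And>t. real_of_int (c t) = real M * y t - y (t + a) - y (t + b)"
  shows "expansion (twisted c n d) t =
    expansion d t + y t - decay y (nat (n - h t)) t + carry c (nat (n - h t)) d t"
proof -
  have "expansion (twisted c n d) t = expansion d t + y t - decay y m t + carry c m d t"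
    if "nat (n - h t) = m" for m
    using that
  proof (induction m arbitrary: t)
    case 0
    have "twisted c n d s = d s" if "h s \<ge> h t" for s
      using 0 that d by (simp add: twisted_def twist_def)
    then have "expansion (twisted c n d) t = expansion d t" by (rule expansion_cong_above)
    then show ?case by simp
  next
    case (Suc m)
    then have lt: "h t < n" and m: "nat (n - h t) - 1 = m" "nat (n - h (t + a)) = m" "nat (n - h (t + b)) = m"
      by simp_all
    let ?w = "int (d t) + (c t - carry c m d (t + a) - carry c m d (t + b))"
    have "int (twisted c n d t) = ?w mod int M"
      using lt m(1) M_pos by (simp add: twisted_def twist_def)
    also have "\<dots> = ?w + int M * carry c (Suc m) d t"
      by (simp add: minus_mult_div_eq_mod[symmetric])
    finally have "real_of_int (int (twisted c n d t)) = real_of_int (?w + int M * carry c (Suc m) d t)"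
      by (rule arg_cong)
    then have digit: "real (twisted c n d t) = real (d t) + real_of_int (c t) -
        real_of_int (carry c m d (t + a)) - real_of_int (carry c m d (t + b)) +
        real M * real_of_int (carry c (Suc m) d t)"
      by (simp del: carry.simps)
    have "M * expansion (twisted c n d) t =
        M * (expansion d t + y t - decay y (Suc m) t + carry c (Suc m) d t)"
    proof -
      have "M * decay y (Suc m) t = decay y m (t + a) + decay y m (t + b)"
        using M_pos by simp
      then show ?thesis
        using expansion_rec[OF twisted_in_words[of c n d], of t] expansion_rec[OF d, of t]
          Suc.IH[OF m(2)] Suc.IH[OF m(3)] digit c[of t] unfolding ring_distribs by linarith
    qed
    then show ?case using M_pos by (simp only: mult_cancel_left) simp
  qed
  then show ?thesis by blast
qed

lemma decay_bounds:
  assumes "\<And>t. 0 \<le> y t" "\<And>t. y t \<le> 1"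
  shows "0 \<le> decay y m t \<and> decay y m t \<le> (2 / M) ^ m"
proof (induction m arbitrary: t)
  case (Suc m)
  have "decay y (Suc m) t \<le> ((2 / M) ^ m + (2 / M) ^ m) / M"
    unfolding decay.simps using Suc by (intro divide_right_mono add_mono) auto
  also have "\<dots> = (2 / M) ^ Suc m" by simp
  finally show ?case using Suc by simp
qed (use assms in simp)

lemma coding_twisted_tendsto:
  assumes d: "d \<in> words"
    and c: "\<And>t. real_of_int (c t) = real M * y t - y (t + a) - y (t + b)"
    and y: "\<And>t. 0 \<le> y t" "\<And>t. y t \<le> 1"
  shows "(\<lambda>k. coding (twisted c (int k) d)) \<longlonglongrightarrow> coding d + (\<lambda>t. to_circle (y t))"
proof (rule tendsto_pointwise)
  fix t
  let ?m = "\<lambda>k. nat (int k - h t)"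
  have "(\<lambda>m. decay y m t) \<longlonglongrightarrow> 0"
    using M3 decay_bounds[of y] y
    by (intro tendsto_sandwich[OF _ _ tendsto_const LIMSEQ_realpow_zero[of "2 / M"]])
      (auto intro!: always_eventually)
  moreover have "filterlim ?m sequentially sequentially"
    unfolding filterlim_at_top
  proof
    fix Z :: nat
    show "\<forall>\<^sub>F k in sequentially. Z \<le> ?m k"
      by (rule eventually_sequentiallyI[of "nat (int Z + h t)"]) linarith
  qed
  ultimately have "(\<lambda>k. decay y (?m k) t) \<longlonglongrightarrow> 0" by (rule filterlim_compose)
  then have "(\<lambda>k. expansion d t + y t - decay y (?m k) t) \<longlonglongrightarrow> expansion d t + y t - 0"
    by (intro tendsto_diff tendsto_const)
  then have lim: "(\<lambda>k. to_circle (expansion d t + y t - decay y (?m k) t)) \<longlonglongrightarrow>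
      to_circle (expansion d t + y t - 0)"
    by (rule continuous_on_tendsto_compose[OF continuous_on_to_circle]) simp_all
  have "to_circle (expansion d t + y t - decay y (?m k) t) = coding (twisted c (int k) d) t" for k
    unfolding coding_def expansion_twisted[OF d c] to_circle_eq_iff by simp
  with lim show "(\<lambda>k. coding (twisted c (int k) d) t) \<longlonglongrightarrow> (coding d + (\<lambda>t. to_circle (y t))) t"
    by (simp add: coding_def to_circle_add)
qed

lemma X_lift:
  assumes "x \<in> X"
  obtains c y where "\<And>t. real_of_int (c t) = real M * y t - y (t + a) - y (t + b)"
    "\<And>t. 0 \<le> y t" "\<And>t. y t \<le> (1 :: real)" "x = (\<lambda>t. to_circle (y t))"
proof -
  define y where "y t = rep_circle (x t) - of_int \<lfloor>rep_circle (x t)\<rfloor>" for t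
  have xy: "x t = to_circle (y t)" for t
    unfolding y_def to_circle_minus_floor by (metis Quotient_abs_rep Quotient_circle)
  have "0 \<le> y t" "y t \<le> 1" for t unfolding y_def by linarith+
  moreover have "\<exists>n :: int. of_int n = M * y t - y (t + a) - y (t + b)" for t
  proof -
    have "to_circle (M * y t) = to_circle (y (t + a) + y (t + b))"
      using assms by (simp add: X_def xy int_scale_to_circle to_circle_add)
    then show ?thesis by (auto simp: to_circle_eq_iff Ints_def diff_diff_eq)
  qed
  then obtain c where "\<And>t. real_of_int (c t) = real M * y t - y (t + a) - y (t + b)" by metis
  ultimately show ?thesis using that xy by blast
qed

lemma coding_sets: "B \<in> sets borel \<Longrightarrow> {d \<in> words. coding d \<in> B} \<in> sets \<nu>"
  using measurable_sets[OF measurable_coding] by (simp add: space_bernoulli_measure vimage_def Int_def conj_commute)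

text \<open>The codes of the twisted configurations converge to \<open>coding d + y\<close>, so they eventually lie in
  the open set \<open>U\<close> whenever the limit does, and each of them has the law of \<open>coding d\<close>. Fatou's
  lemma gives the inequality.\<close>

lemma emeasure_coding_translate_le:
  assumes "y \<in> X" and U: "open U"
  shows "emeasure \<nu> {d \<in> words. coding d + y \<in> U} \<le> emeasure \<nu> {d \<in> words. coding d \<in> U}"
proof -
  obtain c y' where c: "\<And>t. real_of_int (c t) = real M * y' t - y' (t + a) - y' (t + b)"
    "\<And>t. 0 \<le> y' t" "\<And>t. y' t \<le> (1 :: real)" and y: "y = (\<lambda>t. to_circle (y' t))"
    using X_lift[OF assms(1)] by metis
  let ?V = "{d \<in> words. coding d \<in> U}" and ?W = "{d \<in> words. coding d + y \<in> U}"
  let ?Vk = "\<lambda>k. {d \<in> words. coding (twisted c (int k) d) \<in> U}"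
  have V: "?V \<in> sets \<nu>" using U by (intro coding_sets) simp
  have W: "?W \<in> sets \<nu>"
    using coding_sets[of "{z. z + y \<in> U}"] open_circle_translate[OF U, of y] by simp
  have twisted: "twisted c n \<in> measurable \<nu> \<nu>" for n
    unfolding twisted_def using M_pos
    by (intro measurable_into_bernoulli_measure
        measurable_count_space_combine[where H = "\<lambda>x y. nat ((int x + y) mod int M)",
          OF measurable_bernoulli_coordinate measurable_twist]) (simp add: nat_less_iff)
  have Vk_eq: "?Vk k = twisted c (int k) -` ?V \<inter> space \<nu>" for k
    using twisted_in_words by (auto simp: space_bernoulli_measure)
  have Vk: "?Vk k \<in> sets \<nu>" for k
    unfolding Vk_eq by (rule measurable_sets[OF twisted V])
  have Vk_emeasure: "emeasure \<nu> (?Vk k) = emeasure \<nu> ?V" for k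
    unfolding Vk_eq emeasure_distr[OF twisted V, symmetric] distr_twisted ..
  have "emeasure \<nu> ?W = (\<integral>\<^sup>+d. indicator ?W d \<partial>\<nu>)" using W by simp
  also have "\<dots> \<le> (\<integral>\<^sup>+d. liminf (\<lambda>k. indicator (?Vk k) d) \<partial>\<nu>)"
  proof (rule nn_integral_mono)
    fix d
    show "(indicator ?W d :: ennreal) \<le> liminf (\<lambda>k. indicator (?Vk k) d)"
    proof (cases "d \<in> ?W")
      case True
      then have "\<forall>\<^sub>F k in sequentially. coding (twisted c (int k) d) \<in> U"
        using coding_twisted_tendsto[OF _ c, of d] U by (auto simp: y dest: topological_tendstoD)
      then have "\<forall>\<^sub>F k in sequentially. (1 :: ennreal) \<le> indicator (?Vk k) d"
        by (rule eventually_mono) (use True in simp)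
      then show ?thesis using Liminf_bounded[of "1 :: ennreal"] True by simp
    qed simp
  qed
  also have "\<dots> \<le> liminf (\<lambda>k. \<integral>\<^sup>+d. indicator (?Vk k) d \<partial>\<nu>)"
    using Vk by (intro nn_integral_liminf) simp
  also have "\<dots> = emeasure \<nu> ?V"
    unfolding nn_integral_indicator[OF Vk] Vk_emeasure by (simp add: Liminf_const)
  finally show ?thesis .
qed

text \<open>The reverse inequality is the previous one for \<open>-y\<close> and the translate of \<open>U\<close>.\<close>

lemma emeasure_coding_translate_open:
  assumes y: "y \<in> X" and U: "open U"
  shows "emeasure \<nu> {d \<in> words. coding d + y \<in> U} = emeasure \<nu> {d \<in> words. coding d \<in> U}"
proof (rule antisym[OF emeasure_coding_translate_le[OF assms]])
  show "emeasure \<nu> {d \<in> words. coding d \<in> U} \<le> emeasure \<nu> {d \<in> words. coding d + y \<in> U}"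
    using emeasure_coding_translate_le[OF X_minus[OF y] open_circle_translate[OF U, of y]] by simp
qed

lemma emeasure_coding_translate:
  assumes y: "y \<in> X" and B: "B \<in> sets borel"
  shows "emeasure \<nu> {d \<in> words. coding d + y \<in> B} = emeasure \<nu> {d \<in> words. coding d \<in> B}"
proof -
  interpret prob_space \<nu> by (rule prob_space_bernoulli_measure[OF M_pos])
  have T: "(\<lambda>d. coding d + y) \<in> borel_measurable \<nu>"
    by (rule measurable_compose[OF measurable_coding measurable_circle_translate])
  have em: "emeasure (distr \<nu> borel (\<lambda>d. coding d + y)) B = emeasure \<nu> {d \<in> words. coding d + y \<in> B}"
    "emeasure (distr \<nu> borel coding) B = emeasure \<nu> {d \<in> words. coding d \<in> B}"
    if "B \<in> sets borel" for B
    using that by (simp_all add: emeasure_distr[OF T] emeasure_distr[OF measurable_coding]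
      space_bernoulli_measure vimage_def Int_def conj_commute)
  have "distr \<nu> borel (\<lambda>d. coding d + y) = distr \<nu> borel coding"
  proof (rule measure_eqI_generator_eq[where E = "{S. open S}" and \<Omega> = UNIV and A = "\<lambda>_. UNIV"])
    show "Int_stable {S :: ('g \<Rightarrow> circle) set. open S}" by (auto simp: Int_stable_def)
    show "emeasure (distr \<nu> borel (\<lambda>d. coding d + y)) U = emeasure (distr \<nu> borel coding) U"
      if "U \<in> {S. open S}" for U
      using that emeasure_coding_translate_open[OF y, of U] by (simp add: em)
    show "emeasure (distr \<nu> borel (\<lambda>d. coding d + y)) UNIV \<noteq> \<infinity>"
      using em(1)[of UNIV] by simp
  qed (auto simp: sets_borel)
  then show ?thesis using em[OF B] by simp
qed

definition coding_law :: "('g \<Rightarrow> circle) measure" where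
  "coding_law = distr \<nu> (restrict_space borel X) coding"

lemma measurable_coding_X: "coding \<in> measurable \<nu> (restrict_space borel X)"
  using measurable_coding coding_in_X
  by (intro measurable_restrict_space2) (auto simp: space_bernoulli_measure)

lemma sets_coding_law: "sets coding_law = sets (restrict_space borel X)"
  by (simp add: coding_law_def)

lemma emeasure_coding_law: "B \<in> sets borel \<Longrightarrow> emeasure coding_law (X \<inter> B) = emeasure \<nu> {d \<in> words. coding d \<in> B}"
proof -
  assume B: "B \<in> sets borel"
  then have "emeasure coding_law (X \<inter> B) = emeasure \<nu> (coding -` (X \<inter> B) \<inter> space \<nu>)"
    unfolding coding_law_def by (intro emeasure_distr[OF measurable_coding_X]) (auto simp: sets_restrict_space)
  also have "coding -` (X \<inter> B) \<inter> space \<nu> = {d \<in> words. coding d \<in> B}"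
    using coding_in_X by (auto simp: space_bernoulli_measure)
  finally show ?thesis .
qed

lemma is_normalized_haar_coding_law: "is_normalized_haar X coding_law"
  unfolding is_normalized_haar_def
proof (intro conjI ballI)
  show "sets coding_law = sets (restrict_space borel X)" by (rule sets_coding_law)
  show "prob_space coding_law"
    unfolding coding_law_def
    by (rule prob_space.prob_space_distr[OF prob_space_bernoulli_measure[OF M_pos] measurable_coding_X])
  fix x A assume x: "x \<in> X" and A: "A \<in> sets coding_law"
  then obtain B where B: "B \<in> sets borel" "A = X \<inter> B"
    by (auto simp: sets_coding_law sets_restrict_space)
  from measurable_sets_Collect[OF measurable_circle_translate[of "- x"], of "\<lambda>z. z \<in> B"] B(1)
  have B': "{z. z + - x \<in> B} \<in> sets borel" by simp
  have "(\<lambda>y. x + y) ` A = X \<inter> {z. z + - x \<in> B}"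
  proof (intro set_eqI iffI)
    fix z assume "z \<in> X \<inter> {z. z + - x \<in> B}"
    then show "z \<in> (\<lambda>y. x + y) ` A"
      using X_add[OF _ X_minus[OF x], of z] B(2) by (intro image_eqI[of _ _ "z + - x"]) auto
  qed (use x X_add B(2) in auto)
  then have "emeasure coding_law ((\<lambda>y. x + y) ` A) = emeasure \<nu> {d \<in> words. coding d + - x \<in> B}"
    using emeasure_coding_law[OF B'] by simp
  also have "\<dots> = emeasure coding_law A"
    using emeasure_coding_translate[OF X_minus[OF x] B(1)] emeasure_coding_law[OF B(1)] B(2) by simp
  finally show "emeasure coding_law ((\<lambda>y. x + y) ` A) = emeasure coding_law A" .
qed

lemma haar_measure_eq_coding_law: "haar_measure X = coding_law"
  using X_add X_minus is_normalized_haar_coding_law by (rule haar_measure_eqI)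

section \<open>The isomorphism\<close>

lemma compact_words: "compact words"
proof -
  have "compactin (product_topology (\<lambda>_ :: 'g. euclidean) UNIV) (PiE UNIV (\<lambda>_. {0..<M}))"
    unfolding compactin_PiE by (simp add: finite_imp_compact)
  moreover have "PiE UNIV (\<lambda>_ :: 'g. {0..<M}) = words" by (auto simp: PiE_UNIV_domain)
  ultimately show ?thesis by (simp add: euclidean_product_topology)
qed

lemma coding_image_borel:
  assumes "closed C"
  shows "coding ` {d \<in> words. d \<in> C} \<in> sets borel"
proof -
  have "{d \<in> words. d \<in> C} = words \<inter> C" by auto
  then have "compact {d \<in> words. d \<in> C}"
    using compact_Int_closed[OF compact_words assms] by simp
  moreover have "continuous_on {d \<in> words. d \<in> C} coding"
    by (rule continuous_on_subset[OF continuous_on_coding]) blast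
  ultimately have "compact (coding ` {d \<in> words. d \<in> C})"
    by (intro compact_continuous_image)
  then show ?thesis by (intro borel_closed compact_imp_closed_fun)
qed

lemma coding_exceptional_borel: "coding ` exceptional \<in> sets borel"
proof -
  have "exceptional = (\<Union>t. {d \<in> words. d \<in> (\<Inter>n. {d. percolates (M - 1) (M - 2) n d t})} \<union>
      {d \<in> words. d \<in> (\<Inter>n. {d. percolates 0 1 n d t})})"
    by (auto simp: exceptional_def)
  then have "coding ` exceptional = (\<Union>t. coding ` {d \<in> words. d \<in> (\<Inter>n. {d. percolates (M - 1) (M - 2) n d t})} \<union>
      coding ` {d \<in> words. d \<in> (\<Inter>n. {d. percolates 0 1 n d t})})"
    by (simp only: image_UN image_Un)
  also have "\<dots> \<in> sets borel"
    by (intro sets.countable_UN'' sets.Un coding_image_borel closed_INT ballI closed_percolates) simp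
  finally show ?thesis .
qed

definition generic :: "('g \<Rightarrow> nat) set" where
  "generic = words - exceptional"

lemma generic_words: "d \<in> generic \<Longrightarrow> d \<in> words"
  unfolding generic_def by blast

lemma coding_unique_generic: "d \<in> generic \<Longrightarrow> d' \<in> words \<Longrightarrow> coding d = coding d' \<Longrightarrow> d = d'"
  using coding_unique unfolding generic_def by blast

lemma generic_sets: "generic \<in> sets \<nu>"
  using sets.Diff[OF sets.top null_setsD2[OF null_exceptional]]
  by (simp add: generic_def space_bernoulli_measure)

text \<open>An exceptional configuration never shares its code with a generic one, so the image of the
  generic set is the difference of two images of countable unions of compact sets.\<close>

lemma coding_generic_sets: "coding ` generic \<in> sets coding_law"
proof -
  have "coding ` generic = coding ` words - coding ` exceptional"
  proof (intro set_eqI iffI)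
    fix x assume "x \<in> coding ` generic"
    then obtain d where d: "d \<in> generic" "x = coding d" by blast
    have "d' \<notin> exceptional" if "coding d' = x" for d'
    proof
      assume d': "d' \<in> exceptional"
      then have "d' \<in> words" by (simp add: exceptional_def)
      then have "d = d'" using coding_unique_generic[OF d(1)] d(2) that by simp
      then show False using d(1) d' by (simp add: generic_def)
    qed
    then show "x \<in> coding ` words - coding ` exceptional"
      using d generic_words by blast
  qed (auto simp: generic_def)
  moreover have "coding ` words \<in> sets borel"
    using coding_image_borel[of UNIV] by simp
  ultimately have "coding ` generic \<in> sets borel"
    using coding_exceptional_borel by simp
  moreover have "coding ` generic = X \<inter> coding ` generic"
    using coding_in_X generic_words by blast
  ultimately show ?thesis by (auto simp: sets_coding_law sets_restrict_space)
qed

lemma coding_law_off_generic: "emeasure coding_law (space coding_law - coding ` generic) = 0"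
proof -
  have "emeasure coding_law (space coding_law - coding ` generic) =
      emeasure \<nu> (coding -` (space coding_law - coding ` generic) \<inter> space \<nu>)"
    using coding_generic_sets unfolding coding_law_def
    by (intro emeasure_distr[OF measurable_coding_X]) (auto simp flip: coding_law_def sets_coding_law)
  also have "\<dots> = 0"
  proof (rule emeasure_eq_0[OF null_setsD2[OF null_exceptional] null_setsD1[OF null_exceptional]])
    show "coding -` (space coding_law - coding ` generic) \<inter> space \<nu> \<subseteq> exceptional"
      by (auto simp: generic_def space_bernoulli_measure)
  qed
  finally show ?thesis .
qed

lemma shift_generic: "d \<in> generic \<Longrightarrow> shift_action s d \<in> generic"
proof -
  assume d: "d \<in> generic"
  have "shift_action s d \<notin> exceptional"
  proof
    assume "shift_action s d \<in> exceptional"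
    then have "\<exists>t. (\<forall>n. percolates (M - 1) (M - 2) n d (- s + t)) \<or> (\<forall>n. percolates 0 1 n d (- s + t))"
      by (simp add: exceptional_def percolates_shift)
    then have "d \<in> exceptional" using generic_words[OF d] unfolding exceptional_def by blast
    then show False using d by (simp add: generic_def)
  qed
  then show ?thesis using shift_in_words[OF generic_words[OF d]] unfolding generic_def by blast
qed

theorem coding_law_isomorphic_bernoulli: "measurably_isomorphic coding_law shift_action \<nu> shift_action"
proof -
  let ?X = "coding ` generic" and ?\<theta> = "inv_into generic coding"
  have inj: "inj_on coding generic"
    using coding_unique_generic generic_words by (intro inj_onI) blast
  then have \<theta>: "?\<theta> (coding d) = d" if "d \<in> generic" for d
    using that by (rule inv_into_f_f)
  have bij: "bij_betw ?\<theta> ?X generic"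
    using inj by (intro bij_betw_inv_into inj_on_imp_bij_betw)
  have shift_image: "shift_action s ` A = A"
    if A: "\<And>s x. x \<in> A \<Longrightarrow> shift_action s x \<in> A" for s :: 'g and A :: "('g \<Rightarrow> 'c) set"
  proof
    show "A \<subseteq> shift_action s ` A"
    proof
      fix x assume "x \<in> A"
      have "shift_action s (shift_action (- s) x) = x"
        by (simp add: shift_action_def flip: add.assoc)
      then show "x \<in> shift_action s ` A" using A[OF \<open>x \<in> A\<close>, of "- s"] by (metis imageI)
    qed
  qed (use A in blast)
  have null: "emeasure \<nu> (space \<nu> - generic) = 0"
  proof (rule emeasure_eq_0[OF null_setsD2[OF null_exceptional] null_setsD1[OF null_exceptional]])
    show "space \<nu> - generic \<subseteq> exceptional" by (auto simp: generic_def space_bernoulli_measure)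
  qed
  have space_X: "space (restrict_space coding_law ?X) = ?X"
    using sets.sets_into_space[OF coding_generic_sets] by (auto simp: space_restrict_space)
  have \<theta>_meas: "?\<theta> \<in> measurable (restrict_space coding_law ?X) (restrict_space \<nu> generic)"
  proof (rule measurable_restrict_space2)
    show "?\<theta> \<in> space (restrict_space coding_law ?X) \<rightarrow> generic"
      using \<theta> unfolding space_X by auto
    show "?\<theta> \<in> measurable (restrict_space coding_law ?X) \<nu>"
    proof (rule measurable_into_bernoulli_measure)
      show "?\<theta> x t < M" if "x \<in> space (restrict_space coding_law ?X)" for x t
        using that \<theta> generic_words unfolding space_X by auto
      show "(\<lambda>x. ?\<theta> x t) \<in> measurable (restrict_space coding_law ?X) (count_space UNIV)" for t
        unfolding measurable_count_space_eq_countable[OF countableI_type]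
      proof (intro conjI ballI)
        fix v :: nat
        have "closed {d :: 'g \<Rightarrow> nat. d t = v}"
          by (intro closed_Collect_eq continuous_on_product_coordinates continuous_on_const)
        from coding_image_borel[OF this]
        have "coding ` {d \<in> words. d t = v} \<in> sets borel" by simp
        then have "X \<inter> coding ` {d \<in> words. d t = v} \<in> sets coding_law"
          by (auto simp: sets_coding_law sets_restrict_space)
        with coding_generic_sets have "?X \<inter> (X \<inter> coding ` {d \<in> words. d t = v}) \<in> sets coding_law"
          by (rule sets.Int)
        moreover have "(\<lambda>x. ?\<theta> x t) -` {v} \<inter> ?X = ?X \<inter> (X \<inter> coding ` {d \<in> words. d t = v})"
        proof (intro set_eqI iffI)
          fix x assume "x \<in> (\<lambda>x. ?\<theta> x t) -` {v} \<inter> ?X"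
          then obtain d where "d \<in> generic" "x = coding d" "d t = v" using \<theta> by auto
          then show "x \<in> ?X \<inter> (X \<inter> coding ` {d \<in> words. d t = v})"
            using generic_words coding_in_X by blast
        next
          fix x assume "x \<in> ?X \<inter> (X \<inter> coding ` {d \<in> words. d t = v})"
          then obtain d d' where "d \<in> generic" "x = coding d" "d' \<in> words" "x = coding d'" "d' t = v"
            by blast
          moreover from this have "d = d'" by (intro coding_unique_generic) simp_all
          ultimately show "x \<in> (\<lambda>x. ?\<theta> x t) -` {v} \<inter> ?X" using \<theta>[of d] by auto
        qed
        ultimately show "(\<lambda>x. ?\<theta> x t) -` {v} \<inter> space (restrict_space coding_law ?X) \<in> sets (restrict_space coding_law ?X)"
          unfolding space_X
          by (subst sets_restrict_space_iff) (auto intro: coding_generic_sets sets.Int_space_eq2)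
      qed simp
    qed
  qed
  have coding_meas: "coding \<in> measurable (restrict_space \<nu> generic) (restrict_space coding_law ?X)"
    using measurable_coding_X
    by (intro measurable_restrict_space3) (simp_all add: coding_law_def)
  have inv_\<theta>: "inv_into ?X ?\<theta> d = coding d" if "d \<in> generic" for d
    using inv_into_f_f[OF bij_betw_imp_inj_on[OF bij] imageI[OF that]] \<theta>[OF that] by simp
  have space_Y: "space (restrict_space \<nu> generic) = generic"
    using sets.sets_into_space[OF generic_sets] by (auto simp: space_restrict_space)
  have inv_meas: "inv_into ?X ?\<theta> \<in> measurable (restrict_space \<nu> generic) (restrict_space coding_law ?X)"
    using coding_meas inv_\<theta> by (subst measurable_cong[of _ _ coding]) (simp_all add: space_Y)
  have distr: "distr (restrict_space coding_law ?X) (restrict_space \<nu> generic) ?\<theta> = restrict_space \<nu> generic"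
  proof (rule measure_eqI)
    fix A assume "A \<in> sets (distr (restrict_space coding_law ?X) (restrict_space \<nu> generic) ?\<theta>)"
    then have A: "A \<in> sets (restrict_space \<nu> generic)" by simp
    then have AY: "A \<subseteq> generic" using sets.sets_into_space space_Y by blast
    have "?\<theta> -` A \<inter> ?X = coding ` A"
    proof (intro set_eqI iffI)
      fix x assume "x \<in> ?\<theta> -` A \<inter> ?X"
      then obtain d where d: "d \<in> generic" "x = coding d" "?\<theta> x \<in> A" by blast
      then show "x \<in> coding ` A" using \<theta>[OF d(1)] by simp
    next
      fix x assume "x \<in> coding ` A"
      then obtain d where d: "d \<in> A" "x = coding d" by blast
      then have "d \<in> generic" using AY by blast
      then show "x \<in> ?\<theta> -` A \<inter> ?X" using \<theta>[of d] d by simp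
    qed
    then have CA: "coding ` A \<in> sets (restrict_space coding_law ?X)"
      using measurable_sets[OF \<theta>_meas A] unfolding space_X by simp
    then have CA': "coding ` A \<in> sets coding_law"
      using coding_generic_sets by (auto simp: sets_restrict_space_iff sets.Int_space_eq2)
    have "emeasure (distr (restrict_space coding_law ?X) (restrict_space \<nu> generic) ?\<theta>) A =
        emeasure (restrict_space coding_law ?X) (coding ` A)"
      using \<open>?\<theta> -` A \<inter> ?X = coding ` A\<close> by (simp only: emeasure_distr[OF \<theta>_meas A] space_X)
    also have "\<dots> = emeasure coding_law (coding ` A)"
      using AY coding_generic_sets by (intro emeasure_restrict_space) (auto simp: sets.Int_space_eq2)
    also have "\<dots> = emeasure \<nu> (coding -` (coding ` A) \<inter> space \<nu>)"
      using CA' unfolding coding_law_def by (intro emeasure_distr[OF measurable_coding_X]) simp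
    also have "coding -` (coding ` A) \<inter> space \<nu> = A"
    proof (intro set_eqI iffI)
      fix d assume "d \<in> coding -` (coding ` A) \<inter> space \<nu>"
      then obtain d' where "d' \<in> A" "coding d = coding d'" "d \<in> words"
        by (auto simp: space_bernoulli_measure)
      moreover from this have "d' = d" using AY by (intro coding_unique_generic) auto
      ultimately show "d \<in> A" by simp
    next
      fix d assume "d \<in> A"
      then show "d \<in> coding -` (coding ` A) \<inter> space \<nu>"
        using AY generic_words[of d] by (auto simp: space_bernoulli_measure)
    qed
    also have "emeasure \<nu> A = emeasure (restrict_space \<nu> generic) A"
      using AY generic_sets by (intro emeasure_restrict_space[symmetric]) (auto simp: sets.Int_space_eq2)
    finally show "emeasure (distr (restrict_space coding_law ?X) (restrict_space \<nu> generic) ?\<theta>) A =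
        emeasure (restrict_space \<nu> generic) A" .
  qed simp
  have shift_X: "shift_action s x \<in> ?X" if "x \<in> ?X" for s x
  proof -
    from that obtain d where d: "d \<in> generic" "x = coding d" by blast
    then have "shift_action s x = coding (shift_action s d)" by (simp only: coding_shift)
    then show ?thesis using shift_generic[OF d(1)] by blast
  qed
  have equivariant: "?\<theta> (shift_action s x) = shift_action s (?\<theta> x)" if "x \<in> ?X" for s x
  proof -
    from that obtain d where d: "d \<in> generic" "x = coding d" by blast
    have "?\<theta> (coding (shift_action s d)) = shift_action s d"
      by (rule \<theta>[OF shift_generic[OF d(1)]])
    then show ?thesis using \<theta>[OF d(1)] d(2) by (simp only: coding_shift)
  qed
  show ?thesis
    unfolding measurably_isomorphic_def
    by (rule exI[of _ ?X], rule exI[of _ generic], rule exI[of _ ?\<theta>], intro conjI allI ballI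
        coding_generic_sets coding_law_off_generic shift_image shift_X generic_sets null
        shift_generic bij \<theta>_meas inv_meas distr equivariant)
qed

end

theorem theorem7p1:
  fixes h :: "'g :: {group_add, countable} \<Rightarrow> int"
    and a b :: 'g
    and M :: nat
    and f :: "'g \<Rightarrow>\<^sub>0 int"
  assumes hom: "\<And>s t. h (s + t) = h s + h t"
    and "a \<noteq> b" and "h a = 1" and "h b = 1"
    and "M \<ge> 3"
    and f: "f = of_nat M - Poly_Mapping.single a 1 - Poly_Mapping.single b 1"
  shows "measurably_isomorphic
           (haar_measure (principal_algebraic f)) shift_action
           (bernoulli_measure M) shift_action"
proof -
  interpret two_generators h a b M
    using assms by unfold_locales
  have "h 0 = 0" using hom[of 0 0] by simp
  then have "a \<noteq> 0" "b \<noteq> 0" using assms(3,4) by auto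
  then have "principal_algebraic f = X"
    unfolding f X_def using assms(2,5) by (intro principal_algebraic_two_generators) auto
  then show ?thesis
    using coding_law_isomorphic_bernoulli haar_measure_eq_coding_law by simp
qed

end
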